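(* Let $\mathbf Y_1,\dots,\mathbf Y_n$ be i.i.d. $N_p(\mathbf 0,\mathbf C)$ random vectors, where $\mathbf C$ is a $p\times p$ correlation matrix. Let $\hat Y_{i,j}=\Phi^{-1}\!\left(\frac{R_{i,j}}{n+1}\right)$, where $R_{i,j}$ is the rank of $Y_{i,j}$ among $Y_{1,j},\dots,Y_{n,j}$, and let $\hat{\mathbf Y}_i=(\hat Y_{i,1},\dots,\hat Y_{i,p})^T$. Let $\mathbf A$ be a real $p\times p$ matrix such that the diagonal entries of $\mathbf A\mathbf C+\mathbf A^T\mathbf C$ are all zero. Then $$\frac1{\sqrt n}\sum_{i=1}^n\left(\hat{\mathbf Y}_i^T\mathbf A\hat{\mathbf Y}_i-\mathbf Y_i^T\mathbf A\mathbf Y_i\right)\xrightarrow{p}0\qquad\text{as } n\to\infty.$$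
   Context: $\Phi$ is the standard normal CDF and $\mathbf Y_i=(Y_{i,1},\dots,Y_{i,p})^T$. The dimension $p$ and the matrices $\mathbf A,\mathbf C$ are fixed as $n\to\infty$. A correlation matrix is a symmetric positive semidefinite matrix with unit diagonal. The ranks are computed separately for each coordinate $j$ among the $n$ observations (ties have probability zero). *)

theory Defs
  imports "HOL-Probability.Probability"
begin

definition correlation_matrix :: "real ^ 'p ^ 'p \<Rightarrow> bool" where
  "correlation_matrix C \<longleftrightarrow>
     transpose C = C \<and> (\<forall>x. 0 \<le> x \<bullet> (C *v x)) \<and> (\<forall>j. C $ j $ j = 1)"

(* Parametrised by mean and standard deviation; standard deviation 0 gives the point mass. *)
definition normal_law :: "real \<Rightarrow> real \<Rightarrow> real measure" where
  "normal_law \<mu> \<sigma> =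
     (if \<sigma> = 0 then return borel \<mu> else density lborel (\<lambda>x. ennreal (normal_density \<mu> \<sigma> x)))"

(* X is N_p(\<mu>, \<Sigma>): every linear combination of its components is univariate normal, possibly
   degenerate.  A density-based definition would exclude singular \<Sigma>. *)
definition multivariate_normal ::
    "'a measure \<Rightarrow> ('a \<Rightarrow> real ^ 'p) \<Rightarrow> real ^ 'p \<Rightarrow> real ^ 'p ^ 'p \<Rightarrow> bool" where
  "multivariate_normal M X \<mu> \<Sigma> \<longleftrightarrow>
     X \<in> borel_measurable M \<and>
     (\<forall>t. distr M borel (\<lambda>\<omega>. t \<bullet> X \<omega>) = normal_law (t \<bullet> \<mu>) (sqrt (t \<bullet> (\<Sigma> *v t))))"

definition std_normal_cdf :: "real \<Rightarrow> real" where
  "std_normal_cdf = cdf std_normal_distribution"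

(* The standard normal CDF is a bijection of the real line onto the open interval (0,1);
   outside that interval the value is unspecified. *)
definition std_normal_quantile :: "real \<Rightarrow> real" where
  "std_normal_quantile = inv std_normal_cdf"

(* Samples of size n are indexed by 0, ..., n - 1, but ranks run from 1 to n. *)
definition sample_rank :: "nat \<Rightarrow> (nat \<Rightarrow> real) \<Rightarrow> nat \<Rightarrow> nat" where
  "sample_rank n y i = card {k. k < n \<and> y k \<le> y i}"

definition normal_scores :: "nat \<Rightarrow> (nat \<Rightarrow> real ^ 'p) \<Rightarrow> nat \<Rightarrow> real ^ 'p" where
  "normal_scores n y i =
     (\<chi> j. std_normal_quantile (real (sample_rank n (\<lambda>k. y k $ j) i) / real (n + 1)))"

(* Measurability is part of the definition, since measure yields 0 on non-measurable sets. *)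
definition converges_in_probability ::
    "'a measure \<Rightarrow> (nat \<Rightarrow> 'a \<Rightarrow> real) \<Rightarrow> real \<Rightarrow> bool" where
  "converges_in_probability M X c \<longleftrightarrow>
     (\<forall>n. X n \<in> borel_measurable M) \<and>
     (\<forall>\<epsilon>>0. (\<lambda>n. measure M {\<omega> \<in> space M. \<bar>X n \<omega> - c\<bar> > \<epsilon>}) \<longlonglongrightarrow> 0)"

end

theory Submission
  imports Defs
begin

text \<open>
  Put \<open>D\<^sub>i\<close> for the difference of the normal scores and the observations, and \<open>Z\<^sub>i = (A + A\<^sup>T) Y\<^sub>i\<close>. Then
  the summand equals \<open>D\<^sub>i \<bullet> A D\<^sub>i + D\<^sub>i \<bullet> Z\<^sub>i\<close>. The hypothesis on \<open>A\<close> says that \<open>Z\<^sub>i\<close> and \<open>Y\<^sub>i\<close> have uncorrelated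
  \<open>j\<close>-th components, so the sequence of \<open>j\<close>-th components of the \<open>Z\<^sub>i\<close> is independent of that of the
  \<open>Y\<^sub>i\<close>, hence of that of the \<open>D\<^sub>i\<close>. Consequently both parts are controlled in \<open>L\<^sup>1\<close> by the single
  number \<open>E (D\<^sub>i\<^sub>j)\<^sup>2\<close>, and \<open>o(1 / sqrt n)\<close> suffices.

  Given \<open>Y\<^sub>i\<^sub>j = y\<close>, the rank is \<open>1 + Bin (n - 1, \<Phi> y)\<close>. Since the normal hazard rate is bounded below,
  \<open>\<bar>x - y\<bar>\<close> is at most a multiple of the distance of the logits of \<open>\<Phi> x\<close> and \<open>\<Phi> y\<close>, and
  \<open>(ln a - ln u)\<^sup>2 \<le> 4 (a - u)\<^sup>2 / (a u) = 4 (a / u + u / a - 2)\<close>, whose binomial expectation is explicit and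
  of order \<open>1 / (n u)\<close>. Integrating over \<open>\<Phi> y \<ge> 1 / (n + 1)\<^sup>2\<close> gives \<open>ln n / n\<close>; on the complement crude moment
  bounds are enough.
\<close>

subsection \<open>The standard normal distribution function\<close>

lemma continuous_on_std_normal_density: "continuous_on S std_normal_density"
  unfolding std_normal_density_def by (intro continuous_intros) auto

text \<open>This links the Lebesgue-based \<open>cdf\<close> to the gauge integral, so that the
  fundamental theorem of calculus yields the derivative. Passing from the half-open to the closed
  interval costs only the null set \<open>{a}\<close>.\<close>

lemma std_normal_cdf_diff:
  assumes "a \<le> y"
  shows "std_normal_cdf y = std_normal_cdf a + integral {a..y} std_normal_density"
proof (cases "a = y")
  case False
  with assms have ay: "a < y" by simp
  interpret N: real_distribution std_normal_distribution by (rule real_dist_normal_dist)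
  have "std_normal_cdf y - std_normal_cdf a = measure std_normal_distribution {a<..y}"
    unfolding std_normal_cdf_def by (rule N.cdf_diff_eq[OF ay])
  also have "\<dots> = integral\<^sup>L std_normal_distribution (indicator {a<..y})"
    by simp
  also have "\<dots> = (LBINT x. std_normal_density x * indicator {a<..y} x)"
    by (subst integral_density) (auto simp: normal_density_nonneg)
  also have "\<dots> = (LINT x:{a..y}|lborel. std_normal_density x)"
    unfolding set_lebesgue_integral_def
    by (rule integral_cong_AE)
       (auto simp: indicator_def intro!: AE_I[where N="{a}"])
  also have "\<dots> = integral {a..y} std_normal_density"
    by (rule set_borel_integral_eq_integral)
       (use borel_integrable_atLeastAtMost'[OF continuous_on_std_normal_density]
         in \<open>simp add: set_integrable_def\<close>)
  finally show ?thesis by simp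
qed simp

lemma DERIV_std_normal_cdf:
  "(std_normal_cdf has_field_derivative std_normal_density x) (at x)"
proof -
  \<comment> \<open>Any base point below \<open>x\<close> would do; the margin 1 on both sides makes
    \<open>x\<close> interior, so the derivative within the interval is a full derivative.\<close>
  let ?a = "x - 1" and ?b = "x + 1"
  have "((\<lambda>y. integral {?a..y} std_normal_density) has_real_derivative std_normal_density x)
      (at x within {?a..?b})"
    by (rule integral_has_real_derivative[OF continuous_on_std_normal_density]) auto
  then have "((\<lambda>y. std_normal_cdf ?a + integral {?a..y} std_normal_density)
      has_real_derivative std_normal_density x) (at x within {?a..?b})"
    by (auto intro!: derivative_eq_intros)
  then have "(std_normal_cdf has_real_derivative std_normal_density x) (at x within {?a..?b})"
    by (rule has_field_derivative_transform_within[where d=1])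
       (use std_normal_cdf_diff in auto)
  then show ?thesis
    by (subst (asm) at_within_Icc_at) auto
qed

lemmas DERIV_std_normal_cdf' [derivative_intros] =
  DERIV_chain2[OF DERIV_std_normal_cdf]

lemma std_normal_cdf_strict_mono: "x < y \<Longrightarrow> std_normal_cdf x < std_normal_cdf y"
  by (rule DERIV_pos_imp_increasing)
     (auto intro!: exI DERIV_std_normal_cdf normal_density_pos)

lemma std_normal_cdf_le_iff [simp]: "std_normal_cdf x \<le> std_normal_cdf y \<longleftrightarrow> x \<le> y"
  using std_normal_cdf_strict_mono by (metis less_le_not_le linorder_le_less_linear order.order_iff_strict)

lemma std_normal_cdf_pos [simp]: "0 < std_normal_cdf x"
  and std_normal_cdf_less_1 [simp]: "std_normal_cdf x < 1"
proof -
  interpret N: real_distribution std_normal_distribution by (rule real_dist_normal_dist)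
  show "0 < std_normal_cdf x"
    using std_normal_cdf_strict_mono[of "x - 1" x] N.cdf_nonneg[of "x - 1"]
    unfolding std_normal_cdf_def by simp
  show "std_normal_cdf x < 1"
    using std_normal_cdf_strict_mono[of x "x + 1"] N.cdf_bounded_prob[of "x + 1"]
    unfolding std_normal_cdf_def by simp
qed

lemma std_normal_cdf_at_top: "(std_normal_cdf \<longlongrightarrow> 1) at_top"
  and std_normal_cdf_at_bot: "(std_normal_cdf \<longlongrightarrow> 0) at_bot"
proof -
  interpret N: real_distribution std_normal_distribution by (rule real_dist_normal_dist)
  show "(std_normal_cdf \<longlongrightarrow> 1) at_top" "(std_normal_cdf \<longlongrightarrow> 0) at_bot"
    unfolding std_normal_cdf_def by (rule N.cdf_lim_at_top_prob N.cdf_lim_at_bot)+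
qed

lemma std_normal_density_minus [simp]: "std_normal_density (- x) = std_normal_density x"
  by (simp add: std_normal_density_def)

text \<open>The density is even, so \<open>std_normal_cdf y + std_normal_cdf (- y)\<close> has
  derivative 0; its constant value is read off at infinity.\<close>

lemma std_normal_cdf_minus: "std_normal_cdf (- x) = 1 - std_normal_cdf x"
proof -
  have const: "std_normal_cdf y + std_normal_cdf (- y) = std_normal_cdf x + std_normal_cdf (- x)" for y
    by (rule DERIV_isconst_all[where f="\<lambda>y. std_normal_cdf y + std_normal_cdf (- y)"])
       (auto intro!: derivative_eq_intros)
  have "((\<lambda>y. std_normal_cdf (- y)) \<longlongrightarrow> 0) at_top"
    by (rule filterlim_compose[OF std_normal_cdf_at_bot filterlim_uminus_at_bot_at_top])
  then have "((\<lambda>y. std_normal_cdf y + std_normal_cdf (- y)) \<longlongrightarrow> 1 + 0) at_top"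
    by (intro tendsto_add std_normal_cdf_at_top)
  also have "(\<lambda>y. std_normal_cdf y + std_normal_cdf (- y)) = (\<lambda>_. std_normal_cdf x + std_normal_cdf (- x))"
    using const by (rule ext)
  finally have "((\<lambda>y::real. std_normal_cdf x + std_normal_cdf (- x)) \<longlongrightarrow> 1 + 0) at_top" .
  then show ?thesis
    by (simp add: tendsto_const_iff)
qed

lemma continuous_on_std_normal_cdf: "continuous_on S std_normal_cdf"
  by (meson DERIV_isCont DERIV_std_normal_cdf continuous_at_imp_continuous_on)

lemma borel_measurable_std_normal_cdf [measurable]: "std_normal_cdf \<in> borel_measurable borel"
  by (rule borel_measurable_continuous_onI[OF continuous_on_std_normal_cdf])

text \<open>The limits at both ends and the intermediate value theorem put \<open>u\<close> in the
  range of the distribution function, which is what \<open>inv\<close> requires.\<close>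

lemma std_normal_cdf_quantile:
  assumes "0 < u" "u < 1"
  shows "std_normal_cdf (std_normal_quantile u) = u"
proof -
  have "eventually (\<lambda>x. std_normal_cdf x > u) at_top"
    by (rule order_tendstoD(1)[OF std_normal_cdf_at_top assms(2)])
  then obtain b where b: "std_normal_cdf b > u"
    by (auto dest: eventually_happens)
  have "eventually (\<lambda>x. std_normal_cdf x < u) at_bot"
    by (rule order_tendstoD(2)[OF std_normal_cdf_at_bot assms(1)])
  then obtain a where a: "std_normal_cdf a < u"
    by (auto dest: eventually_happens)
  have "a \<le> b"
    using a b by (metis order.strict_trans std_normal_cdf_le_iff order_less_imp_le)
  then obtain x where "std_normal_cdf x = u"
    using IVT'[of std_normal_cdf a u b] a b continuous_on_std_normal_cdf by auto
  then show ?thesis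
    unfolding std_normal_quantile_def by (auto intro: f_inv_into_f)
qed

section \<open>Hazard rate and the logit bound\<close>

text \<open>A lower bound for the normal hazard rate on the positive half-line. On [0,1] the density
  is at least its value at 1 and the tail is at most 1. Beyond 1 the density dominates the tail
  itself, and \<open>std_normal_density 1\<close> is at most 1.\<close>

lemma std_normal_density_ge_tail:
  assumes "0 \<le> x"
  shows "std_normal_density 1 * std_normal_cdf (- x) \<le> std_normal_density x"
proof (cases "x \<le> 1")
  case True
  have "x\<^sup>2 \<le> 1"
    using assms True by (simp add: abs_square_le_1)
  then have "std_normal_density 1 \<le> std_normal_density x"
    by (simp add: std_normal_density_def divide_right_mono)
  moreover have "std_normal_density 1 * std_normal_cdf (- x) \<le> std_normal_density 1 * 1"
    by (intro mult_left_mono) (auto simp: normal_density_nonneg less_imp_le)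
  ultimately show ?thesis by simp
next
  case False
  \<comment> \<open>The derivative of \<open>?g\<close> is (1 - x) times the density, so
    \<open>?g\<close> decreases on [1, \<infinity>); as it tends to 0, it is nonnegative
    there.\<close>
  let ?g = "\<lambda>x. std_normal_density x - std_normal_cdf (- x)"
  have deriv: "(?g has_real_derivative (std_normal_density x - x * std_normal_density x)) (at x)" for x
    unfolding std_normal_density_def
    by (rule derivative_eq_intros refl | simp add: std_normal_density_def)+
  have "((\<lambda>y. std_normal_cdf (- y)) \<longlongrightarrow> 0) at_top"
    by (rule filterlim_compose[OF std_normal_cdf_at_bot filterlim_uminus_at_bot_at_top])
  moreover have "(std_normal_density \<longlongrightarrow> 0) at_top"
    unfolding std_normal_density_def by real_asymp
  ultimately have lim: "(?g \<longlongrightarrow> 0 - 0) at_top"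
    by (intro tendsto_diff)
  have "?g y \<le> ?g x" if "x \<le> y" for y
  proof (rule DERIV_nonpos_imp_nonincreasing[OF that])
    fix z assume "x \<le> z"
    then have "1 * std_normal_density z \<le> z * std_normal_density z"
      using False by (intro mult_right_mono normal_density_nonneg) auto
    then show "\<exists>d. (?g has_real_derivative d) (at z) \<and> d \<le> 0"
      using deriv by (intro exI conjI) auto
  qed
  then have "eventually (\<lambda>y. ?g y \<le> ?g x) at_top"
    by (rule eventually_at_top_linorderI)
  then have "0 - 0 \<le> ?g x"
    by (rule tendsto_upperbound[OF lim]) simp
  moreover have "std_normal_density 1 \<le> 1"
  proof -
    have "1 \<le> sqrt (2 * pi)"
      using pi_ge_two by (intro real_le_rsqrt) simp
    then show ?thesis
      unfolding std_normal_density_def by (intro mult_le_one) auto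
  qed
  then have "std_normal_density 1 * std_normal_cdf (- x) \<le> 1 * std_normal_cdf (- x)"
    by (intro mult_right_mono) (auto simp: less_imp_le)
  ultimately show ?thesis by linarith
qed

text \<open>The right-hand side is the increment of the logit of the distribution function. Its
  derivative is the sum of the hazard rates of the two tails; the upper one is large enough for
  \<open>z \<ge> 0\<close>, the lower one for \<open>z < 0\<close>.\<close>

lemma ln_std_normal_cdf_gap:
  assumes "x \<le> y"
  shows "std_normal_density 1 * (y - x) \<le>
    (ln (std_normal_cdf y) - ln (std_normal_cdf x))
    + (ln (std_normal_cdf (- x)) - ln (std_normal_cdf (- y)))"
proof -
  let ?F = "\<lambda>x. ln (std_normal_cdf x) - ln (std_normal_cdf (- x)) - std_normal_density 1 * x"
  have "?F x \<le> ?F y"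
  proof (rule DERIV_nonneg_imp_nondecreasing[OF assms])
    fix z
    have D: "(?F has_real_derivative std_normal_density z / std_normal_cdf z
        + std_normal_density z / std_normal_cdf (- z) - std_normal_density 1) (at z)"
      by (rule derivative_eq_intros refl | simp)+
    have "std_normal_density 1 \<le> std_normal_density z / std_normal_cdf z
        + std_normal_density z / std_normal_cdf (- z)"
    proof (cases "z \<ge> 0")
      case True
      have "std_normal_density 1 \<le> std_normal_density z / std_normal_cdf (- z)"
        using std_normal_density_ge_tail[OF True] by (simp add: le_divide_eq)
      then show ?thesis
        by (simp add: add_increasing normal_density_nonneg less_imp_le)
    next
      case False
      then have "std_normal_density 1 \<le> std_normal_density z / std_normal_cdf z"
        using std_normal_density_ge_tail[of "- z"] by (simp add: le_divide_eq)
      then show ?thesis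
        by (simp add: add_increasing2 normal_density_nonneg less_imp_le)
    qed
    with D show "\<exists>y. (?F has_real_derivative y) (at z) \<and> 0 \<le> y"
      by (intro exI[of _ "std_normal_density z / std_normal_cdf z
        + std_normal_density z / std_normal_cdf (- z) - std_normal_density 1"] conjI) auto
  qed
  then show ?thesis
    by (simp add: algebra_simps)
qed

text \<open>With \<open>s = sqrt (a / b)\<close> and \<open>b \<le> a\<close>, the bound ln s \<le>
  s - 1 and the factorisation of s^2 - 1 give the claim. The symmetric denominator
  \<open>a * b\<close> makes the case distinction harmless and later leads to explicit binomial
  expectations.\<close>

lemma ln_diff_squared_le:
  fixes a b :: real
  assumes "0 < a" "0 < b"
  shows "(ln a - ln b)\<^sup>2 \<le> 4 * ((a - b)\<^sup>2 / (a * b))"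
proof -
  have *: "(ln a - ln b)\<^sup>2 \<le> 4 * ((a - b)\<^sup>2 / (a * b))" if "0 < b" "b \<le> a" for a b :: real
  proof -
    define s where "s = sqrt (a / b)"
    have s: "1 \<le> s" "s\<^sup>2 = a / b"
      using that by (auto simp: s_def)
    have "ln a - ln b = 2 * ln s"
      using that by (simp add: s_def ln_div ln_sqrt)
    also have "\<dots> \<le> 2 * (s - 1)"
      using ln_le_minus_one[of s] s by simp
    finally have "(ln a - ln b)\<^sup>2 \<le> (2 * (s - 1))\<^sup>2"
      by (rule power_mono) (use that in simp)
    also have "\<dots> \<le> 4 * ((s\<^sup>2 - 1)\<^sup>2 / s\<^sup>2)"
    proof -
      have "(s - 1)\<^sup>2 * s\<^sup>2 \<le> (s - 1)\<^sup>2 * (s + 1)\<^sup>2"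
        using s by (intro mult_left_mono power_mono) auto
      also have "\<dots> = (s\<^sup>2 - 1)\<^sup>2"
        by (simp add: power2_eq_square algebra_simps)
      finally show ?thesis
        using s(1) unfolding power_mult_distrib by (simp add: pos_le_divide_eq)
    qed
    also have "(s\<^sup>2 - 1)\<^sup>2 / s\<^sup>2 = (a - b)\<^sup>2 / (a * b)"
      using that unfolding s(2) by (simp add: field_simps power2_eq_square)
    finally show ?thesis .
  qed
  show ?thesis
  proof (cases "b \<le> a")
    case False
    then show ?thesis
      using *[of a b] assms by (simp add: power2_commute mult.commute)
  qed (use * assms in auto)
qed

text \<open>Combines the logit bound with \<open>ln_diff_squared_le\<close>. The constant 8 is the
  factor 2 from squaring a difference of two terms times the 4 of that lemma.\<close>

lemma squared_diff_le_std_normal_cdf: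
  "(x - y)\<^sup>2 \<le> 8 / (std_normal_density 1)\<^sup>2 *
    ((std_normal_cdf x - std_normal_cdf y)\<^sup>2 / (std_normal_cdf x * std_normal_cdf y)
     + (std_normal_cdf x - std_normal_cdf y)\<^sup>2 / (std_normal_cdf (- x) * std_normal_cdf (- y)))"
proof -
  let ?c = "std_normal_density 1"
  let ?L1 = "ln (std_normal_cdf x) - ln (std_normal_cdf y)"
  let ?L2 = "ln (std_normal_cdf (- x)) - ln (std_normal_cdf (- y))"
  let ?d = "(std_normal_cdf x - std_normal_cdf y)\<^sup>2"
  let ?R = "?d / (std_normal_cdf x * std_normal_cdf y) + ?d / (std_normal_cdf (- x) * std_normal_cdf (- y))"
  have c: "0 < ?c" by (simp add: normal_density_pos)
  have "?c * \<bar>x - y\<bar> \<le> \<bar>?L1 - ?L2\<bar>"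
    using ln_std_normal_cdf_gap[of x y] ln_std_normal_cdf_gap[of y x] by (auto simp: abs_if)
  then have "(?c * \<bar>x - y\<bar>)\<^sup>2 \<le> \<bar>?L1 - ?L2\<bar>\<^sup>2"
    using c by (intro power_mono) auto
  also have "\<dots> \<le> 2 * (?L1\<^sup>2 + ?L2\<^sup>2)"
    using sum_squares_ge_zero[of "?L1 + ?L2" 0] by (simp add: power2_eq_square algebra_simps)
  also have "\<dots> \<le> 2 * (4 * ?R)"
    using ln_diff_squared_le[of "std_normal_cdf x" "std_normal_cdf y"]
      ln_diff_squared_le[of "std_normal_cdf (- x)" "std_normal_cdf (- y)"]
    by (simp add: std_normal_cdf_minus power2_commute)
  finally show ?thesis
    using c by (simp add: power_mult_distrib field_simps)
qed

section \<open>Tail estimates and integrals under the standard normal law\<close>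

lemma std_normal_cdf_chebyshev:
  assumes "t \<le> 0"
  shows "std_normal_cdf t * t\<^sup>2 \<le> 1"
proof -
  interpret N: real_distribution std_normal_distribution by (rule real_dist_normal_dist)
  have "std_normal_cdf t * t\<^sup>2 = (LINT x|std_normal_distribution. t\<^sup>2 * indicator {..t} x)"
    by (simp add: std_normal_cdf_def cdf_def)
  \<comment> \<open>The exponent is written \<open>2 * 1\<close> to match the shape of the even
    moments.\<close>
  also have "\<dots> \<le> (LINT x|std_normal_distribution. x ^ (2 * 1))"
  proof (rule integral_mono)
    show "integrable std_normal_distribution (\<lambda>x. t\<^sup>2 * indicat_real {..t} x)"
      by (intro integrable_mult_right integrable_real_indicator) (auto simp: N.emeasure_eq_measure)
    show "t\<^sup>2 * indicat_real {..t} x \<le> x ^ (2 * 1)" for x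
      using assms abs_le_square_iff[of t x] by (auto simp: indicator_def)
  qed (rule integrable_std_normal_distribution_moment)
  also have "\<dots> = 1"
    unfolding std_normal_distribution_even_moments by simp
  finally show ?thesis .
qed

text \<open>Chebyshev read backwards: the tail beyond the quantile, on the side of its sign, has
  mass at least \<open>1 / m\<close>. With \<open>m = n + 1\<close> this bounds every normal score
  of a sample of size \<open>n\<close>.\<close>

lemma std_normal_quantile_squared_le:
  assumes "0 < m" "1 / m \<le> a" "a \<le> 1 - 1 / m"
  shows "(std_normal_quantile a)\<^sup>2 \<le> m"
proof -
  let ?q = "std_normal_quantile a"
  have a: "0 < a" "a < 1"
    using assms zero_less_divide_1_iff[of m] by linarith+
  have "1 / m * ?q\<^sup>2 \<le> 1"
  proof (cases "?q \<le> 0")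
    case True
    have "1 / m * ?q\<^sup>2 \<le> std_normal_cdf ?q * ?q\<^sup>2"
      using assms a by (intro mult_right_mono) (auto simp: std_normal_cdf_quantile)
    with std_normal_cdf_chebyshev[OF True] show ?thesis by simp
  next
    case False
    have "1 / m * ?q\<^sup>2 \<le> std_normal_cdf (- ?q) * (- ?q)\<^sup>2"
      unfolding power2_minus using assms a
      by (intro mult_right_mono) (auto simp: std_normal_cdf_quantile std_normal_cdf_minus)
    with std_normal_cdf_chebyshev[of "- ?q"] False show ?thesis by simp
  qed
  then show ?thesis
    using assms(1) by (simp add: divide_le_eq)
qed

text \<open>Lets integrals concerning the upper tail be replaced by those of the lower tail.\<close>

lemma std_normal_distribution_mirror:
  assumes [measurable]: "f \<in> borel_measurable borel"
  shows "(\<integral>\<^sup>+x. f (- x) \<partial>std_normal_distribution) = (\<integral>\<^sup>+x. f x \<partial>std_normal_distribution)"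
proof -
  have "(\<integral>\<^sup>+x. f x \<partial>std_normal_distribution) = (\<integral>\<^sup>+x. ennreal (std_normal_density x) * f x \<partial>lborel)"
    by (subst nn_integral_density) auto
  also have "\<dots> = (\<integral>\<^sup>+x. ennreal (std_normal_density (- x)) * f (- x) \<partial>lborel)"
    by (subst nn_integral_real_affine[where c="-1" and t=0]) auto
  also have "\<dots> = (\<integral>\<^sup>+x. f (- x) \<partial>std_normal_distribution)"
    by (subst nn_integral_density) auto
  finally show ?thesis by simp
qed

text \<open>Against Lebesgue measure the integrand is the derivative of
  \<open>ln (std_normal_cdf y)\<close>. This is the source of the logarithm in the final error
  bound.\<close>

lemma nn_integral_inverse_std_normal_cdf:
  assumes "0 < \<epsilon>" "\<epsilon> < 1"
  shows "(\<integral>\<^sup>+y. ennreal (1 / std_normal_cdf y) * indicator {y. \<epsilon> \<le> std_normal_cdf y} y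
    \<partial>std_normal_distribution) = ennreal (- ln \<epsilon>)"
proof -
  let ?q = "std_normal_quantile \<epsilon>"
  have q: "std_normal_cdf ?q = \<epsilon>"
    using std_normal_cdf_quantile assms by simp
  have set_eq: "{y. \<epsilon> \<le> std_normal_cdf y} = {?q..}"
    using std_normal_cdf_le_iff[of ?q] by (auto simp: q)
  have "(\<integral>\<^sup>+y. ennreal (1 / std_normal_cdf y) * indicator {y. \<epsilon> \<le> std_normal_cdf y} y
      \<partial>std_normal_distribution)
    = (\<integral>\<^sup>+y. ennreal (std_normal_density y / std_normal_cdf y) * indicator {?q..} y \<partial>lborel)"
    unfolding set_eq
    by (subst nn_integral_density)
       (auto intro!: nn_integral_cong simp: ennreal_mult'[symmetric] normal_density_nonneg
         mult.assoc[symmetric])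
  also have "\<dots> = ennreal (ln 1 - ln (std_normal_cdf ?q))"
  proof (rule nn_integral_FTC_atLeast)
    show "((\<lambda>y. ln (std_normal_cdf y)) \<longlongrightarrow> ln 1) at_top"
      by (intro tendsto_ln std_normal_cdf_at_top) auto
    show "((\<lambda>y. ln (std_normal_cdf y)) has_real_derivative std_normal_density x / std_normal_cdf x) (at x)" for x
      by (rule derivative_eq_intros refl | simp)+
  qed (auto simp: normal_density_nonneg less_imp_le)
  finally show ?thesis by (simp add: q)
qed

lemma emeasure_std_normal_cdf_less:
  assumes "0 < \<epsilon>" "\<epsilon> < 1"
  shows "emeasure std_normal_distribution {y. std_normal_cdf y < \<epsilon>} \<le> ennreal \<epsilon>"
proof -
  interpret N: real_distribution std_normal_distribution by (rule real_dist_normal_dist)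
  let ?q = "std_normal_quantile \<epsilon>"
  have q: "std_normal_cdf ?q = \<epsilon>"
    using std_normal_cdf_quantile assms by simp
  have "emeasure std_normal_distribution {y. std_normal_cdf y < \<epsilon>}
      \<le> emeasure std_normal_distribution {..?q}"
  proof (intro emeasure_mono subsetI)
    fix y assume "y \<in> {y. std_normal_cdf y < \<epsilon>}"
    then have "std_normal_cdf y \<le> std_normal_cdf ?q"
      by (simp add: q)
    then show "y \<in> {..?q}"
      by simp
  qed auto
  also have "\<dots> = ennreal \<epsilon>"
    using q by (simp add: N.emeasure_eq_measure std_normal_cdf_def cdf_def)
  finally show ?thesis .
qed

subsection \<open>Ranks and the binomial distribution\<close>

text \<open>Induction on the index set: integrating out one coordinate is one Bernoulli trial, which
  matches the recursion \<open>binomial_pmf_Suc\<close>. The function \<open>h\<close> is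
  generalised because the step uses the hypothesis both for \<open>h\<close> and for its shift by
  one.\<close>

lemma nn_integral_count_eq_binomial_pmf:
  fixes N :: "real measure" and h :: "nat \<Rightarrow> ennreal"
  assumes "prob_space N" and N: "sets N = sets borel" and "finite J"
  shows "(\<integral>\<^sup>+x. h (card {k \<in> J. x k \<le> y}) \<partial>PiM J (\<lambda>_. N))
    = (\<integral>\<^sup>+k. h k \<partial>binomial_pmf (card J) (measure N {..y}))"
  using \<open>finite J\<close>
proof (induction J arbitrary: h)
  case empty
  show ?case
    using prob_space.prob_le_1[OF assms(1)]
    by (simp add: binomial_pmf_0 PiM_empty nn_integral_count_space_finite)
next
  case (insert j J)
  interpret N: prob_space N by fact
  interpret P: product_sigma_finite "\<lambda>_. N"
    by standard
  note N [measurable_cong]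
  have space_N [simp]: "space N = UNIV"
    using sets_eq_imp_space_eq[OF N] by simp
  let ?p = "measure N {..y}"
  let ?B = "binomial_pmf (card J) ?p"
  have meas: "(\<lambda>x. card {k \<in> I. x k \<le> y}) \<in> measurable (PiM I (\<lambda>_. N)) (count_space UNIV)"
    if "finite I" for I :: "'a set"
  proof -
    have "(\<lambda>x. \<Sum>k\<in>I. if x k \<le> y then 1 else 0 :: nat) \<in> measurable (PiM I (\<lambda>_. N)) (count_space UNIV)"
    proof (intro measurable_sum_nat measurable_If)
      fix k assume "k \<in> I"
      then have [measurable]: "(\<lambda>x. x k) \<in> borel_measurable (PiM I (\<lambda>_. N))"
        using measurable_component_singleton[of k I "\<lambda>_. N"] by (simp add: N cong: measurable_cong_sets)
      show "{x \<in> space (PiM I (\<lambda>_. N)). x k \<le> y} \<in> sets (PiM I (\<lambda>_. N))"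
        by measurable
    qed auto
    then show ?thesis
      using that by (simp only: card_eq_sum sum.inter_filter)
  qed
  have "(\<integral>\<^sup>+x. h (card {k \<in> insert j J. x k \<le> y}) \<partial>PiM (insert j J) (\<lambda>_. N))
    = (\<integral>\<^sup>+x. \<integral>\<^sup>+z. h (card {k \<in> insert j J. (x(j := z)) k \<le> y}) \<partial>N \<partial>PiM J (\<lambda>_. N))"
    using insert.hyps meas[of "insert j J"]
    by (intro P.product_nn_integral_insert) (auto intro: measurable_compose[where N="count_space UNIV"])
  also have "\<dots> = (\<integral>\<^sup>+x. ennreal ?p * h (Suc (card {k \<in> J. x k \<le> y}))
      + ennreal (1 - ?p) * h (card {k \<in> J. x k \<le> y}) \<partial>PiM J (\<lambda>_. N))"
  proof (rule nn_integral_cong)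
    fix x :: "'a \<Rightarrow> real"
    let ?S = "{k \<in> J. x k \<le> y}"
    \<comment> \<open>The new coordinate \<open>z\<close> adds one to the count exactly when
      \<open>z \<le> y\<close>, so the inner integrand takes only two values.\<close>
    have "{k \<in> insert j J. (x(j := z)) k \<le> y} = (if z \<le> y then insert j ?S else ?S)" for z
      using insert.hyps by auto
    then have "h (card {k \<in> insert j J. (x(j := z)) k \<le> y})
      = h (Suc (card ?S)) * indicator {..y} z + h (card ?S) * indicator (- {..y}) z" for z
      using insert.hyps by (auto simp: indicator_def)
    moreover have "emeasure N (- {..y}) = ennreal (1 - ?p)"
      using N.prob_compl[of "{..y}"] by (simp add: N.emeasure_eq_measure N Compl_eq_Diff_UNIV)
    ultimately show "(\<integral>\<^sup>+z. h (card {k \<in> insert j J. (x(j := z)) k \<le> y}) \<partial>N)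
      = ennreal ?p * h (Suc (card ?S)) + ennreal (1 - ?p) * h (card ?S)"
      by (simp add: nn_integral_add nn_integral_cmult_indicator N N.emeasure_eq_measure del: fun_upd_apply)
         (simp add: mult.commute)
  qed
  also have "\<dots> = ennreal ?p * (\<integral>\<^sup>+k. h (Suc k) \<partial>?B) + ennreal (1 - ?p) * (\<integral>\<^sup>+k. h k \<partial>?B)"
    using meas[OF insert.hyps(1)] insert.IH[of "\<lambda>k. h (Suc k)"] insert.IH[of h]
    by (subst nn_integral_add)
       (auto simp: nn_integral_cmult measurable_compose[where N="count_space UNIV"])
  also have "\<dots> = (\<integral>\<^sup>+k. h k \<partial>binomial_pmf (card (insert j J)) ?p)"
    using insert.hyps
    by (simp add: binomial_pmf_Suc mult.commute)
  finally show ?case .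
qed

section \<open>Binomial expectations\<close>

text \<open>Exchanging successes and failures is the substitution of \<open>m - k\<close> for
  \<open>k\<close>. It carries estimates near 0 over to estimates near 1.\<close>

lemma expectation_binomial_pmf_mirror:
  fixes f :: "nat \<Rightarrow> real"
  assumes "u \<in> {0..1}"
  shows "measure_pmf.expectation (binomial_pmf m u) f
    = measure_pmf.expectation (binomial_pmf m (1 - u)) (\<lambda>k. f (m - k))"
proof -
  have "(\<Sum>k\<le>m. (m choose k) * u ^ k * (1 - u) ^ (m - k) * f k)
    = (\<Sum>k\<le>m. (m choose (m - k)) * u ^ (m - k) * (1 - u) ^ (m - (m - k)) * f (m - k))"
    by (rule sum.reindex_bij_witness[where i="\<lambda>k. m - k" and j="\<lambda>k. m - k"]) auto
  then show ?thesis
    using assms by (simp add: expectation_binomial_pmf' binomial_symmetric[symmetric] mult_ac)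
qed

lemma expectation_binomial_pmf_id:
  assumes "u \<in> {0..1}"
  shows "measure_pmf.expectation (binomial_pmf m u) real = m * u"
proof (cases m)
  case (Suc l)
  have "(\<Sum>k\<le>Suc l. real (Suc l choose k) * u ^ k * (1 - u) ^ (Suc l - k) * k)
    = (\<Sum>k\<le>l. Suc l * u * (real (l choose k) * u ^ k * (1 - u) ^ (l - k)))"
  proof -
    have *: "real (Suc l choose Suc k) * u ^ Suc k * (1 - u) ^ (Suc l - Suc k) * real (Suc k)
      = real (Suc l) * u * (real (l choose k) * u ^ k * (1 - u) ^ (l - k))" for k
    proof -
      have "real (Suc k) * real (Suc l choose Suc k) = real (Suc l) * real (l choose k)"
        unfolding of_nat_mult[symmetric] of_nat_eq_iff using Suc_times_binomial_eq[of l k]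
        by (simp only: mult.commute)
      then show ?thesis
        by (simp add: mult_ac del: of_nat_Suc binomial_Suc_Suc)
    qed
    show ?thesis
      unfolding sum.atMost_Suc_shift * by simp
  qed
  also have "\<dots> = Suc l * u * (u + (1 - u)) ^ l"
    by (subst binomial_ring) (simp add: sum_distrib_left)
  finally show ?thesis
    using assms Suc by (simp add: expectation_binomial_pmf')
qed (use assms in \<open>simp add: binomial_pmf_0\<close>)

text \<open>By the absorption identity, multiplying by \<open>real (Suc m) * u\<close> turns the
  terms into the weights of a binomial law with \<open>Suc m\<close> trials. Only the weight at 0 is
  missing, so their sum is at most 1.\<close>

lemma expectation_binomial_pmf_inverse_Suc:
  assumes "0 < u" "u < 1"
  shows "measure_pmf.expectation (binomial_pmf m u) (\<lambda>k. 1 / real (Suc k)) \<le> 1 / (real (Suc m) * u)"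
proof -
  let ?w = "\<lambda>k. real (Suc m choose k) * u ^ k * (1 - u) ^ (Suc m - k)"
  have "real (Suc m) * u * measure_pmf.expectation (binomial_pmf m u) (\<lambda>k. 1 / real (Suc k))
    = (\<Sum>k\<le>m. ?w (Suc k))"
  proof -
    have "real (Suc m) * (m choose k) = real (Suc m choose Suc k) * real (Suc k)" for k
      unfolding of_nat_mult[symmetric] of_nat_eq_iff by (rule Suc_times_binomial_eq)
    then have "real (Suc m) * (m choose k) / real (Suc k) = real (Suc m choose Suc k)" for k
      by (simp del: of_nat_Suc binomial_Suc_Suc)
    moreover have "real (Suc m) * u * (real (m choose k) * u ^ k * (1 - u) ^ (m - k) * (1 / real (Suc k)))
      = real (Suc m) * (m choose k) / real (Suc k) * u ^ Suc k * (1 - u) ^ (Suc m - Suc k)" for k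
      by simp
    ultimately show ?thesis
      using assms by (simp only: expectation_binomial_pmf' sum_distrib_left real_scaleR_def)
        (simp add: expectation_binomial_pmf' sum_distrib_left del: of_nat_Suc binomial_Suc_Suc)
  qed
  also have "\<dots> \<le> (\<Sum>k\<le>Suc m. ?w k)"
    unfolding sum.atMost_Suc_shift using assms by simp
  also have "\<dots> = (u + (1 - u)) ^ Suc m"
    by (subst binomial_ring) simp
  finally show ?thesis
    using assms by (simp add: le_divide_eq mult.commute del: of_nat_Suc)
qed

text \<open>Here \<open>a k\<close> is a rank divided by \<open>n + 1\<close>, for
  \<open>n = Suc m\<close> and rank \<open>Suc k\<close>. The integrand equals a/u + u/a - 2, so
  only the mean of \<open>k\<close> and the mean of \<open>1 / real (Suc k)\<close> are
  required.\<close>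

lemma expectation_binomial_rank_deviation:
  fixes u :: real and m :: nat
  assumes "0 < u" "u < 1"
  defines "a \<equiv> \<lambda>k. real (Suc k) / real (m + 2)"
  shows "measure_pmf.expectation (binomial_pmf m u) (\<lambda>k. (a k - u)\<^sup>2 / (a k * u)) \<le> 2 / (real (Suc m) * u)"
proof -
  let ?E = "measure_pmf.expectation (binomial_pmf m u)"
  have [simp]: "integrable (binomial_pmf m u) f" for f :: "nat \<Rightarrow> real"
    using assms by (intro integrable_binomial_pmf) auto
  have "(a k - u)\<^sup>2 / (a k * u) = (1 + real k) * (1 / (real (m + 2) * u)) + u * real (m + 2) * (1 / real (Suc k)) - 2" for k
  proof -
    define s t where "s = real (Suc k)" and "t = real (m + 2)"
    have "0 < s" "0 < t" "1 + real k = s" by (auto simp: s_def t_def)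
    then show ?thesis
      using assms(1) unfolding a_def s_def[symmetric] t_def[symmetric]
      by (simp add: field_simps power2_eq_square)
  qed
  then have "?E (\<lambda>k. (a k - u)\<^sup>2 / (a k * u))
    = (1 + m * u) * (1 / (real (m + 2) * u)) + u * real (m + 2) * ?E (\<lambda>k. 1 / real (Suc k)) - 2"
    using expectation_binomial_pmf_id[of u m] assms(1,2)
    by (simp del: of_nat_Suc of_nat_add times_divide_eq_right mult_1_right)
  also have "\<dots> \<le> (1 + m * u) * (1 / (real (m + 2) * u)) + u * real (m + 2) * (1 / (real (Suc m) * u)) - 2"
    using assms by (intro diff_right_mono add_left_mono mult_left_mono expectation_binomial_pmf_inverse_Suc) auto
  \<comment> \<open>The leading terms m/(m+2) and 1 are absorbed by the -2. The remainders
    \<open>1 / (real (m + 2) * u)\<close> and \<open>1 / real (Suc m)\<close> are each at most half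
    of the target, the second because \<open>u < 1\<close>.\<close>
  also have "\<dots> \<le> 2 / (real (Suc m) * u)"
  proof -
    have "1 / (real (m + 2) * u) \<le> 1 / (real (Suc m) * u)" "1 / real (Suc m) \<le> 1 / (real (Suc m) * u)"
      using assms by (auto intro!: divide_left_mono mult_right_mono simp: mult_le_cancel_left1)
    moreover have "(1 + m * u) * (1 / (real (m + 2) * u)) = 1 / (real (m + 2) * u) + real m / real (m + 2)"
    proof -
      have "m * u * (1 / (real (m + 2) * u)) = real m / real (m + 2)"
        using assms by (simp del: of_nat_add)
      then show ?thesis
        by (simp only: distrib_right mult_1_left)
    qed
    moreover have "u * real (m + 2) * (1 / (real (Suc m) * u)) = 1 + 1 / real (Suc m)"
    proof -
      have "u * real (m + 2) * (1 / (real (Suc m) * u)) = real (m + 2) / real (Suc m)"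
        using assms(1) by (simp del: of_nat_add of_nat_Suc)
      then show ?thesis
        by (simp add: field_simps)
    qed
    moreover have "real m / real (m + 2) \<le> 1"
      by simp
    ultimately show ?thesis by linarith
  qed
  finally show ?thesis .
qed

text \<open>Ranks reflect: \<open>a (m - k) = 1 - a k\<close>. Mirroring the binomial law therefore
  reduces the upper tail to the previous lemma at \<open>1 - u\<close>.\<close>

lemma expectation_binomial_rank_deviation':
  fixes u :: real and m :: nat
  assumes "0 < u" "u < 1"
  defines "a \<equiv> \<lambda>k. real (Suc k) / real (m + 2)"
  shows "measure_pmf.expectation (binomial_pmf m u) (\<lambda>k. (a k - u)\<^sup>2 / ((1 - a k) * (1 - u)))
    \<le> 2 / (real (Suc m) * (1 - u))"
proof -
  have "measure_pmf.expectation (binomial_pmf m u) (\<lambda>k. (a k - u)\<^sup>2 / ((1 - a k) * (1 - u)))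
    = measure_pmf.expectation (binomial_pmf m (1 - u)) (\<lambda>k. (a (m - k) - u)\<^sup>2 / ((1 - a (m - k)) * (1 - u)))"
    using assms by (intro expectation_binomial_pmf_mirror) auto
  also have "\<dots> = measure_pmf.expectation (binomial_pmf m (1 - u)) (\<lambda>k. (a k - (1 - u))\<^sup>2 / (a k * (1 - u)))"
  proof (rule integral_cong_AE)
    have "a (m - k) = 1 - a k" if "k \<le> m" for k
      using that unfolding a_def by (simp add: field_simps of_nat_diff)
    moreover have "(1 - a k - u)\<^sup>2 = (a k - (1 - u))\<^sup>2" for k
      by (simp add: power2_eq_square algebra_simps)
    ultimately show "AE k in binomial_pmf m (1 - u). (a (m - k) - u)\<^sup>2 / ((1 - a (m - k)) * (1 - u))
        = (a k - (1 - u))\<^sup>2 / (a k * (1 - u))"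
      using assms by (simp add: AE_measure_pmf_iff)
  qed auto
  also have "\<dots> \<le> 2 / (real (Suc m) * (1 - u))"
    using expectation_binomial_rank_deviation[of "1 - u" m] assms unfolding a_def by simp
  finally show ?thesis .
qed

subsection \<open>The error of a normal score\<close>

text \<open>An upper bound for the mean square error of one normal score. The factor 64 is 16 times
  2 tails times the 2 in \<open>- ln \<epsilon> = 2 * ln (real (n + 1))\<close>; 14 is 6 from the
  fourth moment plus 8 from the extreme observations. At \<open>n = 0\<close> division by zero makes
  the value 0.\<close>

definition score_error :: "nat \<Rightarrow> real" where
  "score_error n = (64 / (std_normal_density 1)\<^sup>2 * ln (real (n + 1)) + 14) / real n"

lemma score_error_nonneg: "0 \<le> score_error n"
  by (simp add: score_error_def)

lemma sqrt_score_error_tendsto_0: "(\<lambda>n. sqrt (real n) * score_error n) \<longlonglongrightarrow> 0"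
proof -
  have "(\<lambda>n. sqrt (real n) * ((c * ln (real n + 1) + 14) / real n)) \<longlonglongrightarrow> 0" if "0 < c" for c :: real
    using that by real_asymp
  from this[of "64 / (std_normal_density 1)\<^sup>2"] show ?thesis
    using normal_density_pos[of 1 0 1]
    by (simp add: score_error_def add.commute less_imp_neq[THEN not_sym])
qed

lemma score_error_tendsto_0: "score_error \<longlonglongrightarrow> 0"
proof -
  have "(\<lambda>n. (c * ln (real n + 1) + 14) / real n) \<longlonglongrightarrow> 0" if "0 < c" for c :: real
    using that by real_asymp
  from this[of "64 / (std_normal_density 1)\<^sup>2"] show ?thesis
    using normal_density_pos[of 1 0 1]
    by (simp add: score_error_def[abs_def] add.commute less_imp_neq[THEN not_sym])
qed

section \<open>The joint law of an observation and its rank\<close>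

lemma sample_rank_borel_measurable:
  fixes X :: "nat \<Rightarrow> 'a \<Rightarrow> real"
  assumes X: "\<And>k. k < n \<Longrightarrow> X k \<in> borel_measurable M" and "i < n"
  shows "(\<lambda>\<omega>. sample_rank n (\<lambda>k. X k \<omega>) i) \<in> measurable M (count_space UNIV)"
proof -
  have "(\<lambda>\<omega>. \<Sum>k<n. if X k \<omega> \<le> X i \<omega> then 1 else 0 :: nat) \<in> measurable M (count_space UNIV)"
  proof (intro measurable_sum_nat measurable_If)
    fix k assume "k \<in> {..<n}"
    then have [measurable]: "X k \<in> borel_measurable M" "X i \<in> borel_measurable M"
      using X \<open>i < n\<close> by auto
    show "{\<omega> \<in> space M. X k \<omega> \<le> X i \<omega>} \<in> sets M"
      by measurable
  qed auto
  moreover have "(\<Sum>k<n. if X k \<omega> \<le> X i \<omega> then 1 else 0 :: nat) = sample_rank n (\<lambda>k. X k \<omega>) i" for \<omega>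
    unfolding sample_rank_def by (simp only: card_eq_sum sum.inter_filter[symmetric] finite_lessThan lessThan_iff)
  ultimately show ?thesis by simp
qed

text \<open>Fubini for the product law of the sample: with the value \<open>y\<close> of observation
  \<open>i\<close> held fixed, the rank is one more than the number of other observations not
  exceeding \<open>y\<close>, and that number is binomial.\<close>

lemma nn_integral_sample_rank:
  fixes X :: "nat \<Rightarrow> 'a \<Rightarrow> real" and f :: "nat \<Rightarrow> real \<Rightarrow> ennreal"
  assumes "prob_space M"
    and ind: "prob_space.indep_vars M (\<lambda>_. borel) X UNIV"
    and dist: "\<And>k. distr M borel (X k) = N" and "i < n"
    and f [measurable]: "\<And>k. f k \<in> borel_measurable borel"
  shows "(\<integral>\<^sup>+\<omega>. f (sample_rank n (\<lambda>k. X k \<omega>) i) (X i \<omega>) \<partial>M)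
    = (\<integral>\<^sup>+y. \<integral>\<^sup>+k. f (Suc k) y \<partial>binomial_pmf (n - 1) (measure N {..y}) \<partial>N)"
proof -
  interpret prob_space M by fact
  have X [measurable]: "X k \<in> borel_measurable M" for k
    using ind unfolding indep_vars_def by simp
  have N [measurable_cong]: "sets N = sets borel"
    unfolding dist[of 0, symmetric] by simp
  have "prob_space N"
    using prob_space_distr[OF X, of 0] dist by simp
  interpret P: product_sigma_finite "\<lambda>_. N"
    using \<open>prob_space N\<close> by (simp add: product_sigma_finite_def prob_space_imp_sigma_finite)
  define J where "J = {..<n} - {i}"
  have J: "finite J" "i \<notin> J" "insert i J = {..<n}" "card J = n - 1"
    using \<open>i < n\<close> by (auto simp: J_def)
  let ?g = "\<lambda>x. f (sample_rank n x i) (x i)"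
  have g: "?g \<in> borel_measurable (PiM {..<n} (\<lambda>_. borel))"
  proof -
    have comp: "(\<lambda>x. x k) \<in> borel_measurable (PiM {..<n} (\<lambda>_. borel :: real measure))" if "k < n" for k
      using that by (intro measurable_component_singleton) auto
    have "(\<lambda>x. sample_rank n x i) \<in> measurable (PiM {..<n} (\<lambda>_. borel :: real measure)) (count_space UNIV)"
      using \<open>i < n\<close> by (intro sample_rank_borel_measurable comp)
    then show ?thesis
      by (rule measurable_compose_countable'[where I=UNIV and f="\<lambda>r x. f r (x i)",
            OF measurable_compose[OF comp[OF \<open>i < n\<close>] f]]) simp
  qed
  have sets_PiM: "sets (PiM {..<n} (\<lambda>_. N)) = sets (PiM {..<n} (\<lambda>_. borel))"
    by (intro sets_PiM_cong N) auto
  have g_N: "?g \<in> borel_measurable (PiM {..<n} (\<lambda>_. N))"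
    by (subst measurable_cong_sets[OF sets_PiM refl]) (rule g)
  have distr_PiM: "distr M (PiM {..<n} (\<lambda>_. borel)) (\<lambda>\<omega>. \<lambda>k\<in>{..<n}. X k \<omega>) = PiM {..<n} (\<lambda>_. N)"
    using indep_vars_iff_distr_eq_PiM[where I="{..<n}" and X=X and M'="\<lambda>_. borel"]
      indep_vars_subset[OF ind, of "{..<n}"] \<open>i < n\<close> by (auto simp: dist)
  have "(\<integral>\<^sup>+\<omega>. f (sample_rank n (\<lambda>k. X k \<omega>) i) (X i \<omega>) \<partial>M)
    = (\<integral>\<^sup>+\<omega>. ?g (\<lambda>k\<in>{..<n}. X k \<omega>) \<partial>M)"
  \<comment> \<open>The rank looks only at indices below \<open>n\<close>, so restricting the sample
    to \<open>{..<n}\<close> does not change it.\<close>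
  proof (intro nn_integral_cong)
    fix \<omega>
    have "{k. k < n \<and> X k \<omega> \<le> X i \<omega>}
      = {k. k < n \<and> (\<lambda>k\<in>{..<n}. X k \<omega>) k \<le> (\<lambda>k\<in>{..<n}. X k \<omega>) i}"
      using \<open>i < n\<close> by auto
    then have "sample_rank n (\<lambda>k. X k \<omega>) i = sample_rank n (\<lambda>k\<in>{..<n}. X k \<omega>) i"
      unfolding sample_rank_def by (rule arg_cong)
    then show "f (sample_rank n (\<lambda>k. X k \<omega>) i) (X i \<omega>) = ?g (\<lambda>k\<in>{..<n}. X k \<omega>)"
      using \<open>i < n\<close> by simp
  qed
  also have "\<dots> = (\<integral>\<^sup>+x. ?g x \<partial>PiM {..<n} (\<lambda>_. N))"
    unfolding distr_PiM[symmetric]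
    by (subst nn_integral_distr) (simp_all add: g measurable_restrict)
  also have "\<dots> = (\<integral>\<^sup>+y. \<integral>\<^sup>+x. ?g (x(i := y)) \<partial>PiM J (\<lambda>_. N) \<partial>N)"
    unfolding J(3)[symmetric]
    by (rule P.product_nn_integral_insert_rev[OF J(1,2)]) (simp only: J(3) g_N)
  also have "\<dots> = (\<integral>\<^sup>+y. \<integral>\<^sup>+x. f (Suc (card {k \<in> J. x k \<le> y})) y \<partial>PiM J (\<lambda>_. N) \<partial>N)"
  proof (intro nn_integral_cong)
    fix x :: "nat \<Rightarrow> real" and y
    \<comment> \<open>Observation \<open>i\<close> always counts itself, whence the
      \<open>Suc\<close>.\<close>
    have "{k. k < n \<and> (x(i := y)) k \<le> (x(i := y)) i} = insert i {k \<in> J. x k \<le> y}"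
      using J by (auto simp: J_def)
    then have "sample_rank n (x(i := y)) i = card (insert i {k \<in> J. x k \<le> y})"
      unfolding sample_rank_def by (rule arg_cong)
    also have "\<dots> = Suc (card {k \<in> J. x k \<le> y})"
      using J by (intro card_insert_disjoint) auto
    finally have "sample_rank n (x(i := y)) i = Suc (card {k \<in> J. x k \<le> y})" .
    then show "?g (x(i := y)) = f (Suc (card {k \<in> J. x k \<le> y})) y"
      by simp
  qed
  also have "\<dots> = (\<integral>\<^sup>+y. \<integral>\<^sup>+k. f (Suc k) y \<partial>binomial_pmf (n - 1) (measure N {..y}) \<partial>N)"
    using nn_integral_count_eq_binomial_pmf[OF \<open>prob_space N\<close> N J(1), of "\<lambda>k. f (Suc k) y" y for y]
    by (simp only: J(4))
  finally show ?thesis .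
qed

text \<open>Two bounds for the conditional mean square error given the observation \<open>y\<close>.
  The first has order 1/n for central \<open>y\<close> but degenerates when one tail probability is
  tiny; the second is usable for every \<open>y\<close>.\<close>

lemma binomial_score_deviation:
  fixes m :: nat and y :: real
  defines "n \<equiv> Suc m" and "\<Phi> \<equiv> std_normal_cdf"
  shows "(\<integral>\<^sup>+k. ennreal ((std_normal_quantile (real (Suc k) / real (n + 1)) - y)\<^sup>2) \<partial>binomial_pmf m (\<Phi> y))
    \<le> ennreal (16 / (std_normal_density 1)\<^sup>2 / real n * (1 / \<Phi> y + 1 / \<Phi> (- y)))" (is ?tail)
    and "(\<integral>\<^sup>+k. ennreal ((std_normal_quantile (real (Suc k) / real (n + 1)) - y)\<^sup>2) \<partial>binomial_pmf m (\<Phi> y))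
    \<le> ennreal (2 / real n * y ^ 4 + real (4 * n + 2))" (is ?crude)
proof -
  define u where "u = \<Phi> y"
  define a where "a k = real (Suc k) / real (m + 2)" for k
  let ?q = std_normal_quantile
  let ?E = "measure_pmf.expectation (binomial_pmf m u)"
  let ?c = "8 / (std_normal_density 1)\<^sup>2"
  have u: "0 < u" "u < 1" by (auto simp: u_def \<Phi>_def)
  have [simp]: "integrable (binomial_pmf m u) f" for f :: "nat \<Rightarrow> real"
    using u by (intro integrable_binomial_pmf) auto
  have a: "0 < a k" "a k < 1" if "k \<le> m" for k
    using that by (auto simp: a_def)
  have a_eq: "real (Suc k) / real (n + 1) = a k" for k
    by (simp add: a_def n_def)
  have int_eq: "(\<integral>\<^sup>+k. ennreal ((?q (real (Suc k) / real (n + 1)) - y)\<^sup>2) \<partial>binomial_pmf m (\<Phi> y))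
      = ennreal (?E (\<lambda>k. (?q (a k) - y)\<^sup>2))"
    unfolding u_def[symmetric] a_eq by (intro nn_integral_eq_integral) auto
  have "?E (\<lambda>k. (?q (a k) - y)\<^sup>2)
      \<le> ?E (\<lambda>k. ?c * ((a k - u)\<^sup>2 / (a k * u) + (a k - u)\<^sup>2 / ((1 - a k) * (1 - u))))"
  proof (rule integral_mono_AE)
    show "AE k in binomial_pmf m u. (?q (a k) - y)\<^sup>2
        \<le> ?c * ((a k - u)\<^sup>2 / (a k * u) + (a k - u)\<^sup>2 / ((1 - a k) * (1 - u)))"
    proof (rule AE_pmfI)
      fix k assume "k \<in> set_pmf (binomial_pmf m u)"
      then have "k \<le> m" using u by simp
      then show "(?q (a k) - y)\<^sup>2
        \<le> ?c * ((a k - u)\<^sup>2 / (a k * u) + (a k - u)\<^sup>2 / ((1 - a k) * (1 - u)))"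
        using squared_diff_le_std_normal_cdf[of "?q (a k)" y] a
        by (simp add: std_normal_cdf_minus std_normal_cdf_quantile u_def \<Phi>_def)
    qed
  qed auto
  also have "\<dots> = ?c * (?E (\<lambda>k. (a k - u)\<^sup>2 / (a k * u)) + ?E (\<lambda>k. (a k - u)\<^sup>2 / ((1 - a k) * (1 - u))))"
    by (subst integral_mult_right_zero, subst Bochner_Integration.integral_add) auto
  also have "\<dots> \<le> ?c * (2 / (real n * u) + 2 / (real n * (1 - u)))"
    using expectation_binomial_rank_deviation[OF u, of m] expectation_binomial_rank_deviation'[OF u, of m]
    unfolding a_def n_def by (intro mult_left_mono add_mono) auto
  also have "\<dots> = 16 / (std_normal_density 1)\<^sup>2 / real n * (1 / u + 1 / (1 - u))"
  proof -
    have "8 / d * (2 / (N * u) + 2 / (N * v)) = 16 / d / N * (1 / u + 1 / v)" for d N v :: real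
      by (simp add: add_divide_distrib distrib_left mult_ac)
    then show ?thesis .
  qed
  finally show ?tail
    unfolding int_eq by (intro ennreal_leI) (simp add: u_def \<Phi>_def std_normal_cdf_minus)
  have "?E (\<lambda>k. (?q (a k) - y)\<^sup>2) \<le> ?E (\<lambda>k. 2 / real n * y ^ 4 + real (4 * n + 2))"
  proof (rule integral_mono_AE)
    show "AE k in binomial_pmf m u. (?q (a k) - y)\<^sup>2 \<le> 2 / real n * y ^ 4 + real (4 * n + 2)"
    proof (rule AE_pmfI)
      fix k assume "k \<in> set_pmf (binomial_pmf m u)"
      then have "k \<le> m" using u by simp
      \<comment> \<open>All values \<open>a k\<close> lie between 1/(m+2) and 1 - 1/(m+2).\<close>
      then have q: "(?q (a k))\<^sup>2 \<le> real (m + 2)"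
        by (intro std_normal_quantile_squared_le) (auto simp: a_def divide_simps)
      have "(?q (a k) - y)\<^sup>2 \<le> 2 * (?q (a k))\<^sup>2 + 2 * y\<^sup>2"
        using zero_le_power2[of "?q (a k) + y"] by (simp add: power2_eq_square algebra_simps)
      \<comment> \<open>This splits the square into a part with coefficient 1/n, which may be
        integrated over the whole line, and a constant, which will be charged only to a rare
        event.\<close>
      moreover have "y\<^sup>2 \<le> y ^ 4 / real n + real n"
      proof -
        have "0 \<le> (y\<^sup>2 - real n / 2)\<^sup>2 + 3 / 4 * (real n)\<^sup>2"
          by simp
        also have "\<dots> = y ^ 4 - real n * y\<^sup>2 + (real n)\<^sup>2"
          by (simp add: power2_diff power_mult[symmetric] power_divide)
        finally show ?thesis
          unfolding n_def by (simp add: field_simps power2_eq_square del: of_nat_Suc)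
      qed
      ultimately show "(?q (a k) - y)\<^sup>2 \<le> 2 / real n * y ^ 4 + real (4 * n + 2)"
        using q by (simp add: n_def)
    qed
  qed auto
  then show ?crude
    unfolding int_eq by (intro ennreal_leI) simp
qed

text \<open>The conditional bound of order 1/n is integrated where both tail probabilities of
  \<open>y\<close> are at least \<epsilon>, and the crude bound is used elsewhere. Symmetry of the
  normal law identifies the contributions of the two tails.\<close>

lemma normal_score_deviation:
  fixes X :: "nat \<Rightarrow> 'a \<Rightarrow> real"
  assumes "prob_space M"
    and "prob_space.indep_vars M (\<lambda>_. borel) X UNIV"
    and "\<And>k. distr M borel (X k) = std_normal_distribution" and "i < n"
  shows "(\<integral>\<^sup>+\<omega>. ennreal ((std_normal_quantile (real (sample_rank n (\<lambda>k. X k \<omega>) i) / real (n + 1)) - X i \<omega>)\<^sup>2) \<partial>M)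
    \<le> ennreal (score_error n)"
proof -
  let ?N = std_normal_distribution and ?\<Phi> = std_normal_cdf
  obtain m where n: "n = Suc m"
    using \<open>i < n\<close> by (cases n) auto
  \<comment> \<open>The square balances both regimes: \<open>- ln \<epsilon>\<close> is still
    logarithmic in \<open>n\<close>, while the crude constant of order n times the exceptional
    probability of order \<epsilon> is O(1/n).\<close>
  define \<epsilon> where "\<epsilon> = 1 / (real (n + 1))\<^sup>2"
  have \<epsilon>: "0 < \<epsilon>" "\<epsilon> < 1"
    by (auto simp: \<epsilon>_def n intro: one_less_power)
  define c where "c = 16 / (std_normal_density 1)\<^sup>2 / real n"
  have c: "0 \<le> c" by (simp add: c_def)
  let ?T = "\<lambda>y. ennreal (1 / ?\<Phi> y) * indicator {y. \<epsilon> \<le> ?\<Phi> y} y"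
  let ?S = "indicator {y. ?\<Phi> y < \<epsilon>}"
  let ?G = "\<lambda>y. \<integral>\<^sup>+k. ennreal ((std_normal_quantile (real (Suc k) / real (n + 1)) - y)\<^sup>2)
    \<partial>binomial_pmf (n - 1) (?\<Phi> y)"
  have G: "?G y \<le> ennreal c * (?T y + ?T (- y)) + (ennreal (2 / real n) * ennreal (y ^ 4)
      + ennreal (real (4 * n + 2)) * (?S y + ?S (- y)))" for y
  proof (cases "\<epsilon> \<le> ?\<Phi> y \<and> \<epsilon> \<le> ?\<Phi> (- y)")
    case True
    have "?G y \<le> ennreal (c * (1 / ?\<Phi> y + 1 / ?\<Phi> (- y)))"
      using binomial_score_deviation(1)[of m y] by (simp add: n c_def)
    also have "\<dots> = ennreal c * (?T y + ?T (- y))"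
      using True c by (simp add: ennreal_mult' ennreal_plus[symmetric] less_imp_le del: ennreal_plus)
    also have "\<dots> \<le> ennreal c * (?T y + ?T (- y)) + (ennreal (2 / real n) * ennreal (y ^ 4)
        + ennreal (real (4 * n + 2)) * (?S y + ?S (- y)))"
      by (simp add: add_increasing2)
    finally show ?thesis .
  next
    case False
    have "?G y \<le> ennreal (2 / real n * y ^ 4 + real (4 * n + 2))"
      using binomial_score_deviation(2)[of m y] by (simp add: n)
    also have "\<dots> = ennreal (2 / real n) * ennreal (y ^ 4) + ennreal (real (4 * n + 2)) * 1"
      by (simp add: ennreal_mult'[symmetric] ennreal_plus[symmetric] zero_le_even_power del: ennreal_plus)
    \<comment> \<open>Outside the central region at least one of the two indicators is 1.\<close>
    also have "\<dots> \<le> ennreal (2 / real n) * ennreal (y ^ 4) + ennreal (real (4 * n + 2)) * (?S y + ?S (- y))"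
      using False by (intro add_left_mono mult_left_mono) (auto simp: indicator_def)
    also have "\<dots> \<le> ennreal c * (?T y + ?T (- y)) + (ennreal (2 / real n) * ennreal (y ^ 4)
        + ennreal (real (4 * n + 2)) * (?S y + ?S (- y)))"
      by (simp add: add_increasing)
    finally show ?thesis .
  qed
  have "(\<integral>\<^sup>+\<omega>. ennreal ((std_normal_quantile (real (sample_rank n (\<lambda>k. X k \<omega>) i) / real (n + 1)) - X i \<omega>)\<^sup>2) \<partial>M)
    = (\<integral>\<^sup>+y. ?G y \<partial>?N)"
    using nn_integral_sample_rank[OF assms, of "\<lambda>r x. ennreal ((std_normal_quantile (real r / real (n + 1)) - x)\<^sup>2)"]
    by (simp add: std_normal_cdf_def cdf_def)
  also have "\<dots> \<le> (\<integral>\<^sup>+y. ennreal c * (?T y + ?T (- y)) + (ennreal (2 / real n) * ennreal (y ^ 4)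
      + ennreal (real (4 * n + 2)) * (?S y + ?S (- y))) \<partial>?N)"
    by (intro nn_integral_mono G)
  also have "\<dots> = ennreal c * ((\<integral>\<^sup>+y. ?T y \<partial>?N) + (\<integral>\<^sup>+y. ?T (- y) \<partial>?N))
      + (ennreal (2 / real n) * (\<integral>\<^sup>+y. ennreal (y ^ 4) \<partial>?N)
      + ennreal (real (4 * n + 2)) * ((\<integral>\<^sup>+y. ?S y \<partial>?N) + (\<integral>\<^sup>+y. ?S (- y) \<partial>?N)))"
    by (simp add: nn_integral_add nn_integral_cmult)
  also have "(\<integral>\<^sup>+y. ?T (- y) \<partial>?N) = (\<integral>\<^sup>+y. ?T y \<partial>?N)"
    by (rule std_normal_distribution_mirror) measurable
  also have "(\<integral>\<^sup>+y. ?S (- y) \<partial>?N) = (\<integral>\<^sup>+y. ?S y \<partial>?N)"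
    by (rule std_normal_distribution_mirror) measurable
  also have "(\<integral>\<^sup>+y. ?T y \<partial>?N) = ennreal (- ln \<epsilon>)"
    by (rule nn_integral_inverse_std_normal_cdf[OF \<epsilon>])
  also have "(\<integral>\<^sup>+y. ?S y \<partial>?N) = emeasure ?N {y. ?\<Phi> y < \<epsilon>}"
    by (rule nn_integral_indicator) measurable
  also have "(\<integral>\<^sup>+y. ennreal (y ^ 4) \<partial>?N) = ennreal 3"
    using std_normal_distribution_even_moments[of 2]
    by (subst nn_integral_eq_integral) (auto simp: fact_numeral zero_le_even_power)
  also have "ennreal c * (ennreal (- ln \<epsilon>) + ennreal (- ln \<epsilon>)) + (ennreal (2 / real n) * ennreal 3
      + ennreal (real (4 * n + 2)) * (emeasure ?N {y. ?\<Phi> y < \<epsilon>} + emeasure ?N {y. ?\<Phi> y < \<epsilon>}))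
    \<le> ennreal c * (ennreal (- ln \<epsilon>) + ennreal (- ln \<epsilon>)) + (ennreal (2 / real n) * ennreal 3
      + ennreal (real (4 * n + 2)) * (ennreal \<epsilon> + ennreal \<epsilon>))"
    by (intro add_left_mono mult_left_mono add_mono emeasure_std_normal_cdf_less \<epsilon>) auto
  also have "\<dots> = ennreal (c * (2 * - ln \<epsilon>) + (2 / real n * 3 + real (4 * n + 2) * (2 * \<epsilon>)))"
    using \<epsilon> c by (simp add: ennreal_mult'[symmetric] ennreal_plus[symmetric] ln_le_zero_iff mult_nonneg_nonpos less_imp_le del: ennreal_plus ennreal_numeral)
  also have "\<dots> \<le> ennreal (score_error n)"
  proof (rule ennreal_leI)
    have "- ln \<epsilon> = 2 * ln (real (n + 1))"
      by (simp add: \<epsilon>_def ln_div ln_realpow del: of_nat_add)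
    moreover have "real (4 * n + 2) * (2 * \<epsilon>) \<le> 8 / real n"
    proof -
      have "real (4 * n + 2) * (2 * \<epsilon>) \<le> 8 * real (n + 1) * \<epsilon>"
        using \<epsilon> by (simp add: algebra_simps)
      also have "8 * real (n + 1) * \<epsilon> = 8 / real (n + 1)"
      proof -
        have "8 * x * (1 / x\<^sup>2) = 8 / x" for x :: real
          by (simp add: power2_eq_square)
        then show ?thesis
          by (simp only: \<epsilon>_def)
      qed
      also have "\<dots> \<le> 8 / real n"
        by (simp add: n frac_le)
      finally show ?thesis .
    qed
    ultimately show "c * (2 * - ln \<epsilon>) + (2 / real n * 3 + real (4 * n + 2) * (2 * \<epsilon>)) \<le> score_error n"
      by (simp add: c_def score_error_def add_divide_distrib algebra_simps)
  qed
  finally show ?thesis .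
qed

subsection \<open>Independence of uncorrelated Gaussian components\<close>

text \<open>Scaling a standard normal variable covers the point mass and the density case at once,
  so characteristic functions and moments need no case distinction afterwards.\<close>

lemma normal_law_eq_distr:
  assumes "0 \<le> s"
  shows "normal_law 0 s = distr std_normal_distribution borel (\<lambda>x. s * x)"
proof (cases "s = 0")
  case True
  interpret N: real_distribution std_normal_distribution by (rule real_dist_normal_dist)
  have "distr std_normal_distribution borel (\<lambda>x. 0) = return borel (0::real)"
    by (rule N.distr_const) simp
  then show ?thesis
    by (simp add: True normal_law_def)
next
  case False
  interpret N: real_distribution std_normal_distribution by (rule real_dist_normal_dist)
  have "distributed std_normal_distribution lborel (\<lambda>x. x) std_normal_density"
    by (auto simp: distributed_def distr_id2 intro!: distr_id2)
  from N.normal_density_affine[OF this, of s 0]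
  have "distributed std_normal_distribution lborel (\<lambda>x. s * x) (normal_density 0 s)"
    using False assms by simp
  then have "distr std_normal_distribution lborel (\<lambda>x. s * x) = normal_law 0 s"
    using False by (simp add: distributed_distr_eq_density normal_law_def)
  then show ?thesis
    by (metis distr_cong sets_lborel)
qed

lemma char_normal_law:
  assumes "0 \<le> s"
  shows "char (normal_law 0 s) t = of_real (exp (- (s * t)\<^sup>2 / 2))"
proof -
  have "char (normal_law 0 s) t = char std_normal_distribution (t * s)"
    unfolding normal_law_eq_distr[OF assms] by (simp add: char_def integral_distr mult.assoc)
  then show ?thesis
    by (simp add: char_std_normal_distribution mult.commute)
qed

text \<open>The integral is the characteristic function, at 1, of the univariate normal variable
  \<open>w \<bullet> Y \<omega>\<close>. Singular covariance matrices are included.\<close>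

lemma multivariate_normal_char:
  fixes C :: "real ^ 'p ^ 'p"
  assumes "multivariate_normal M Y 0 C" "correlation_matrix C"
  shows "(CLINT \<omega>|M. iexp (w \<bullet> Y \<omega>)) = of_real (exp (- (w \<bullet> (C *v w)) / 2))"
proof -
  have [measurable]: "Y \<in> borel_measurable M"
    and law: "distr M borel (\<lambda>\<omega>. w \<bullet> Y \<omega>) = normal_law 0 (sqrt (w \<bullet> (C *v w)))"
    using assms(1) unfolding multivariate_normal_def by auto
  have "(CLINT \<omega>|M. iexp (w \<bullet> Y \<omega>)) = char (distr M borel (\<lambda>\<omega>. w \<bullet> Y \<omega>)) 1"
    by (simp add: char_def integral_distr)
  also have "\<dots> = of_real (exp (- (w \<bullet> (C *v w)) / 2))"
    using assms(2) unfolding law correlation_matrix_def by (simp add: char_normal_law)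
  finally show ?thesis .
qed

section \<open>From factorising characteristic functions to independence\<close>

context prob_space
begin

text \<open>The weighted law of \<open>X\<close> with density proportional to \<open>g\<close> has the same characteristic function as
  \<open>X\<close>, so the one-dimensional uniqueness theorem applies.\<close>

lemma char_uncorrelated_imp_uncorrelated:
  fixes X g :: "'a \<Rightarrow> real"
  assumes X [measurable]: "X \<in> borel_measurable M" and g [measurable]: "g \<in> borel_measurable M"
    and bounds: "\<And>\<omega>. 1 \<le> g \<omega>" "\<And>\<omega>. g \<omega> \<le> b"
    and uncorr: "\<And>s. (CLINT \<omega>|M. g \<omega> *\<^sub>R iexp (s * X \<omega>)) = of_real (expectation g) * (CLINT \<omega>|M. iexp (s * X \<omega>))"
    and A: "A \<in> sets borel"
  shows "expectation (\<lambda>\<omega>. g \<omega> * indicator A (X \<omega>)) = expectation g * expectation (\<lambda>\<omega>. indicator A (X \<omega>))"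
proof -
  define c where "c = expectation g"
  have int_g: "integrable M g"
  proof (rule integrable_const_bound[of _ b])
    have "\<bar>g \<omega>\<bar> \<le> b" for \<omega>
      using bounds[of \<omega>] by linarith
    then show "AE \<omega> in M. norm (g \<omega>) \<le> b"
      by simp
  qed simp
  have "1 \<le> c"
    unfolding c_def using integral_mono[OF _ int_g, of "\<lambda>_. 1"] bounds by (simp add: prob_space)
  have g_nonneg: "0 \<le> g \<omega>" for \<omega>
    using bounds(1)[of \<omega>] by simp
  let ?D = "density M (\<lambda>\<omega>. ennreal (g \<omega> / c))"
  have "emeasure ?D (space M) = ennreal (expectation (\<lambda>\<omega>. g \<omega> / c))"
    using int_g g_nonneg \<open>1 \<le> c\<close> by (simp add: emeasure_density nn_integral_eq_integral cong: nn_integral_cong)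
  also have "expectation (\<lambda>\<omega>. g \<omega> / c) = 1"
    using \<open>1 \<le> c\<close> by (simp add: c_def)
  finally have "prob_space ?D"
    by (intro prob_spaceI) simp
  then interpret D: prob_space ?D .
  have "distr ?D borel X = distr M borel X"
  proof (rule Levy_uniqueness)
    show "char (distr ?D borel X) = char (distr M borel X)"
    proof (rule ext)
      fix s
      have "char (distr ?D borel X) s = (CLINT \<omega>|M. (g \<omega> / c) *\<^sub>R iexp (s * X \<omega>))"
        using g_nonneg \<open>1 \<le> c\<close>
        by (simp add: char_def integral_distr integral_density del: scaleR_conv_of_real)
      also have "\<dots> = (CLINT \<omega>|M. (1 / c) *\<^sub>R (g \<omega> *\<^sub>R iexp (s * X \<omega>)))"
        by simp
      also have "\<dots> = (1 / c) *\<^sub>R (CLINT \<omega>|M. g \<omega> *\<^sub>R iexp (s * X \<omega>))"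
        by (rule integral_scaleR_right)
      also have "\<dots> = char (distr M borel X) s"
        using \<open>1 \<le> c\<close> unfolding uncorr c_def[symmetric]
          by (simp add: char_def integral_distr scaleR_conv_of_real)
      finally show "char (distr ?D borel X) s = char (distr M borel X) s" .
    qed
  qed auto
  then have "integral\<^sup>L (distr ?D borel X) (indicat_real A) = integral\<^sup>L (distr M borel X) (indicat_real A)"
    by (simp only:)
  moreover have "integral\<^sup>L (distr ?D borel X) (indicat_real A) = expectation (\<lambda>\<omega>. (g \<omega> / c) *\<^sub>R indicat_real A (X \<omega>))"
    using A g_nonneg \<open>1 \<le> c\<close> by (subst integral_distr) (simp_all add: integral_density)
  moreover have "integral\<^sup>L (distr M borel X) (indicat_real A) = expectation (\<lambda>\<omega>. indicat_real A (X \<omega>))"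
    using A by (subst integral_distr) simp_all
  ultimately have "expectation (\<lambda>\<omega>. (g \<omega> / c) * indicator A (X \<omega>)) = expectation (\<lambda>\<omega>. indicator A (X \<omega>))"
    by simp
  then show ?thesis
    using \<open>1 \<le> c\<close> unfolding c_def[symmetric] by (simp add: divide_eq_eq mult.commute)
qed

text \<open>The weights \<open>2 + cos (t Z)\<close>, \<open>2 + sin (t Z)\<close> and \<open>1 + indicator A X\<close> are shifted copies of the functions of
  interest, so that they are bounded away from \<open>0\<close> and can be normalised to densities.\<close>

lemma prob_Int_eq_of_char_factorizes:
  fixes X Z :: "'a \<Rightarrow> real"
  assumes X [measurable]: "X \<in> borel_measurable M" and Z [measurable]: "Z \<in> borel_measurable M"
    and factor: "\<And>s t. (CLINT \<omega>|M. iexp (s * X \<omega> + t * Z \<omega>))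
      = (CLINT \<omega>|M. iexp (s * X \<omega>)) * (CLINT \<omega>|M. iexp (t * Z \<omega>))"
    and A [measurable]: "A \<in> sets borel" and B [measurable]: "B \<in> sets borel"
  shows "prob ((X -` A \<inter> space M) \<inter> (Z -` B \<inter> space M))
    = prob (X -` A \<inter> space M) * prob (Z -` B \<inter> space M)"
proof -
  have int_iexp [simp]: "integrable M (\<lambda>\<omega>. iexp (h \<omega>))" if "h \<in> borel_measurable M" for h :: "'a \<Rightarrow> real"
    using that integrable_iexp[of "\<lambda>\<omega>. complex_of_real (h \<omega>)"] by simp
  have int_bdd: "integrable M h" if "h \<in> borel_measurable M" "\<And>\<omega>. \<bar>h \<omega>\<bar> \<le> 1" for h :: "'a \<Rightarrow> real"
    using that by (intro integrable_const_bound[of _ 1]) auto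
  have trig: "(CLINT \<omega>|M. (2 + f (t * Z \<omega>)) *\<^sub>R iexp (s * X \<omega>))
      = of_real (expectation (\<lambda>\<omega>. 2 + f (t * Z \<omega>))) * (CLINT \<omega>|M. iexp (s * X \<omega>))"
    if f: "f = sin \<or> f = cos" for f :: "real \<Rightarrow> real" and s t
  proof -
    \<comment> \<open>By Euler's formulas the weight is a combination of \<open>iexp\<close> at
      \<open>t\<close> and \<open>- t\<close>, so by linearity it inherits the factorisation of the
      joint characteristic function.\<close>
    obtain a b :: complex where ab: "\<And>u. of_real (f u) = a * iexp u + b * iexp (- u)"
    proof (cases "f = cos")
      case True
      show ?thesis
        by (rule that[of "1/2" "1/2"]) (simp add: True complex_eq_iff Re_exp Im_exp)
    next
      case False
      with f have f: "f = sin" by simp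
      show ?thesis
        by (rule that[of "- \<i> / 2" "\<i> / 2"]) (simp add: f complex_eq_iff Re_exp Im_exp)
    qed
    have [measurable]: "f \<in> borel_measurable borel"
      using f by (auto intro: borel_measurable_continuous_onI continuous_intros)
    have int_f: "integrable M (\<lambda>\<omega>. f (t * Z \<omega>))"
      using f by (intro int_bdd) auto
    have E_f: "of_real (expectation (\<lambda>\<omega>. f (t * Z \<omega>)))
      = a * (CLINT \<omega>|M. iexp (t * Z \<omega>)) + b * (CLINT \<omega>|M. iexp ((- t) * Z \<omega>))"
    proof -
      have int: "integrable M (\<lambda>\<omega>. a * iexp (t * Z \<omega>))" "integrable M (\<lambda>\<omega>. b * iexp (- (t * Z \<omega>)))"
        by (intro integrable_mult_right int_iexp; measurable)+
      show ?thesis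
        unfolding integral_complex_of_real[symmetric] ab Bochner_Integration.integral_add[OF int]
        by (simp only: integral_mult_right_zero mult_minus_left)
    qed
    have "(CLINT \<omega>|M. (2 + f (t * Z \<omega>)) *\<^sub>R iexp (s * X \<omega>))
      = (CLINT \<omega>|M. 2 * iexp (s * X \<omega>) + (a * iexp (s * X \<omega> + t * Z \<omega>) + b * iexp (s * X \<omega> + (- t) * Z \<omega>)))"
    proof (intro Bochner_Integration.integral_cong refl)
      fix \<omega>
      have "(2 + f (t * Z \<omega>)) *\<^sub>R iexp (s * X \<omega>) = 2 * iexp (s * X \<omega>) + of_real (f (t * Z \<omega>)) * iexp (s * X \<omega>)"
        by (simp add: scaleR_conv_of_real algebra_simps)
      also have "of_real (f (t * Z \<omega>)) * iexp (s * X \<omega>) = a * iexp (s * X \<omega> + t * Z \<omega>) + b * iexp (s * X \<omega> + (- t) * Z \<omega>)"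
        unfolding ab by (simp add: ring_distribs exp_add exp_diff exp_minus field_simps)
      finally show "(2 + f (t * Z \<omega>)) *\<^sub>R iexp (s * X \<omega>)
        = 2 * iexp (s * X \<omega>) + (a * iexp (s * X \<omega> + t * Z \<omega>) + b * iexp (s * X \<omega> + (- t) * Z \<omega>))" .
    qed
    also have "\<dots> = 2 * (CLINT \<omega>|M. iexp (s * X \<omega>))
      + (a * (CLINT \<omega>|M. iexp (s * X \<omega> + t * Z \<omega>)) + b * (CLINT \<omega>|M. iexp (s * X \<omega> + (- t) * Z \<omega>)))"
    proof -
      have int: "integrable M (\<lambda>\<omega>. 2 * iexp (s * X \<omega>))"
        "integrable M (\<lambda>\<omega>. a * iexp (s * X \<omega> + t * Z \<omega>))"
        "integrable M (\<lambda>\<omega>. b * iexp (s * X \<omega> + (- t) * Z \<omega>))"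
        by (intro integrable_mult_right int_iexp; measurable)+
      show ?thesis
        by (simp only: Bochner_Integration.integral_add int Bochner_Integration.integrable_add integral_mult_right_zero)
    qed
    also have "\<dots> = of_real (expectation (\<lambda>\<omega>. 2 + f (t * Z \<omega>))) * (CLINT \<omega>|M. iexp (s * X \<omega>))"
      unfolding factor using E_f int_f
      by (simp add: prob_space algebra_simps del: of_real_mult mult_minus_left of_real_minus)
    finally show ?thesis .
  qed
  \<comment> \<open>First use of the uniqueness argument: the exponential of \<open>X\<close> is
    replaced by the indicator of \<open>A\<close>, while \<open>Z\<close> is still tested by
    trigonometric functions.\<close>
  have E_trig: "expectation (\<lambda>\<omega>. f (t * Z \<omega>) * indicator A (X \<omega>))
      = expectation (\<lambda>\<omega>. f (t * Z \<omega>)) * expectation (\<lambda>\<omega>. indicator A (X \<omega>))"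
    if f: "f = sin \<or> f = cos" for f :: "real \<Rightarrow> real" and t
  proof -
    have [measurable]: "f \<in> borel_measurable borel"
      using f by (auto intro: borel_measurable_continuous_onI continuous_intros)
    have bdd: "\<bar>f u\<bar> \<le> 1" for u
      using f by auto
    have "1 \<le> 2 + f u" "2 + f u \<le> 3" for u
      using bdd[of u] by auto
    then have "expectation (\<lambda>\<omega>. (2 + f (t * Z \<omega>)) * indicator A (X \<omega>))
      = expectation (\<lambda>\<omega>. 2 + f (t * Z \<omega>)) * expectation (\<lambda>\<omega>. indicator A (X \<omega>))"
      by (intro char_uncorrelated_imp_uncorrelated[where b=3] trig f) auto
    moreover have "integrable M (\<lambda>\<omega>. f (t * Z \<omega>))" "integrable M (\<lambda>\<omega>. indicator A (X \<omega>) :: real)"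
      "integrable M (\<lambda>\<omega>. f (t * Z \<omega>) * indicator A (X \<omega>))"
      using bdd by (auto intro!: int_bdd simp: indicator_def)
    ultimately show ?thesis
      by (simp add: ring_distribs prob_space)
  qed
  let ?p = "expectation (\<lambda>\<omega>. indicator A (X \<omega>) :: real)"
  have int_A: "integrable M (\<lambda>\<omega>. indicator A (X \<omega>) :: real)"
    by (intro int_bdd) (auto simp: indicator_def)
  \<comment> \<open>Second use, with roles exchanged: the indicator of \<open>A\<close> is now the
    weight, and the exponential of \<open>Z\<close> is replaced by the indicator of
    \<open>B\<close>.\<close>
  have "expectation (\<lambda>\<omega>. (1 + indicator A (X \<omega>)) * indicator B (Z \<omega>))
    = expectation (\<lambda>\<omega>. 1 + indicator A (X \<omega>)) * expectation (\<lambda>\<omega>. indicator B (Z \<omega>) :: real)"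
  proof (rule char_uncorrelated_imp_uncorrelated[where b=2])
    fix s
    have iexp_eq: "iexp u = of_real (cos u) + \<i> * of_real (sin u)" for u
      by (simp add: complex_eq_iff Re_exp Im_exp)
    have int_trig: "integrable M (\<lambda>\<omega>. cos (s * Z \<omega>) * indicator A (X \<omega>))"
      "integrable M (\<lambda>\<omega>. sin (s * Z \<omega>) * indicator A (X \<omega>))"
      "integrable M (\<lambda>\<omega>. cos (s * Z \<omega>))" "integrable M (\<lambda>\<omega>. sin (s * Z \<omega>))"
      by (auto intro!: int_bdd simp: indicator_def)
    have "(CLINT \<omega>|M. (1 + indicator A (X \<omega>)) *\<^sub>R iexp (s * Z \<omega>))
      = (CLINT \<omega>|M. iexp (s * Z \<omega>) + (of_real (cos (s * Z \<omega>) * indicator A (X \<omega>))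
        + \<i> * of_real (sin (s * Z \<omega>) * indicator A (X \<omega>))))"
    proof (intro Bochner_Integration.integral_cong refl)
      have "(1 + a) *\<^sub>R iexp u = iexp u + (of_real (cos u * a) + \<i> * of_real (sin u * a))" for a u :: real
        unfolding iexp_eq by (simp add: scaleR_conv_of_real algebra_simps)
      then show "(1 + indicator A (X \<omega>)) *\<^sub>R iexp (s * Z \<omega>) = iexp (s * Z \<omega>)
        + (of_real (cos (s * Z \<omega>) * indicator A (X \<omega>)) + \<i> * of_real (sin (s * Z \<omega>) * indicator A (X \<omega>)))" for \<omega> .
    qed
    also have "\<dots> = (CLINT \<omega>|M. iexp (s * Z \<omega>)) + (of_real (expectation (\<lambda>\<omega>. cos (s * Z \<omega>) * indicator A (X \<omega>)))
        + \<i> * of_real (expectation (\<lambda>\<omega>. sin (s * Z \<omega>) * indicator A (X \<omega>))))"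
      using int_trig by (simp del: of_real_mult)
    also have "\<dots> = (CLINT \<omega>|M. iexp (s * Z \<omega>)) + of_real ?p * (of_real (expectation (\<lambda>\<omega>. cos (s * Z \<omega>)))
        + \<i> * of_real (expectation (\<lambda>\<omega>. sin (s * Z \<omega>))))"
      using E_trig[of cos s] E_trig[of sin s] by (simp add: algebra_simps)
    also have "of_real (expectation (\<lambda>\<omega>. cos (s * Z \<omega>))) + \<i> * of_real (expectation (\<lambda>\<omega>. sin (s * Z \<omega>)))
      = (CLINT \<omega>|M. iexp (s * Z \<omega>))"
      unfolding iexp_eq using int_trig by (simp del: of_real_mult)
    finally show "(CLINT \<omega>|M. (1 + indicator A (X \<omega>)) *\<^sub>R iexp (s * Z \<omega>))
      = of_real (expectation (\<lambda>\<omega>. 1 + indicator A (X \<omega>))) * (CLINT \<omega>|M. iexp (s * Z \<omega>))"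
      using int_A by (simp add: prob_space algebra_simps)
  qed (auto simp: indicator_def)
  moreover have "integrable M (\<lambda>\<omega>. indicator A (X \<omega>) * indicator B (Z \<omega>) :: real)"
    "integrable M (\<lambda>\<omega>. indicator B (Z \<omega>) :: real)"
    by (auto intro!: int_bdd simp: indicator_def)
  ultimately have eq: "expectation (\<lambda>\<omega>. indicator A (X \<omega>) * indicator B (Z \<omega>))
    = ?p * expectation (\<lambda>\<omega>. indicator B (Z \<omega>))"
    using int_A by (simp add: ring_distribs prob_space)
  have ind: "expectation (\<lambda>\<omega>. indicator S (W \<omega>)) = prob (W -` S \<inter> space M)"
    if [measurable]: "W \<in> borel_measurable M" "S \<in> sets borel" for W :: "'a \<Rightarrow> real" and S
  proof -
    have "expectation (\<lambda>\<omega>. indicat_real S (W \<omega>)) = expectation (indicat_real (W -` S \<inter> space M))"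
      by (intro Bochner_Integration.integral_cong) (auto simp: indicator_def)
    then show ?thesis by simp
  qed
  have "expectation (\<lambda>\<omega>. indicat_real A (X \<omega>) * indicat_real B (Z \<omega>))
    = expectation (indicat_real ((X -` A \<inter> space M) \<inter> (Z -` B \<inter> space M)))"
    by (intro Bochner_Integration.integral_cong) (auto simp: indicator_def)
  then show ?thesis
    using eq by (simp add: ind)
qed

text \<open>Independence across \<open>k\<close> together with independence of the two functions of
  each single \<open>Y k\<close> makes all of these variables jointly independent. The index set is
  a product with \<open>bool\<close> so that it can later be cut into the \<open>True\<close> half
  and the \<open>False\<close> half.\<close>

lemma indep_vars_pairs:
  fixes Y :: "nat \<Rightarrow> 'a \<Rightarrow> 'b" and f :: "bool \<Rightarrow> 'b \<Rightarrow> real"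
  assumes ind: "indep_vars (\<lambda>_. S) Y UNIV"
    and f: "\<And>b. f b \<in> borel_measurable S"
    and within: "\<And>k A B. A \<in> sets borel \<Longrightarrow> B \<in> sets borel \<Longrightarrow>
      prob (((\<lambda>\<omega>. f True (Y k \<omega>)) -` A \<inter> space M) \<inter> ((\<lambda>\<omega>. f False (Y k \<omega>)) -` B \<inter> space M))
      = prob ((\<lambda>\<omega>. f True (Y k \<omega>)) -` A \<inter> space M) * prob ((\<lambda>\<omega>. f False (Y k \<omega>)) -` B \<inter> space M)"
  shows "indep_vars (\<lambda>_. borel) (\<lambda>j \<omega>. f (snd j) (Y (fst j) \<omega>)) ({..<n} \<times> UNIV)"
proof (cases "n = 0")
  case True
  then show ?thesis
    by (simp add: indep_vars_def indep_sets_def)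
next
  case False
  let ?V = "\<lambda>j \<omega>. f (snd j) (Y (fst j) \<omega>)"
  let ?I = "{..<n} \<times> (UNIV :: bool set)"
  have Y [measurable]: "Y k \<in> measurable M S" for k
    using ind unfolding indep_vars_def by simp
  have V: "?V j \<in> borel_measurable M" for j
    using measurable_compose[OF Y f] by simp
  have "indep_sets (\<lambda>j. {?V j -` A \<inter> space M | A. A \<in> sets borel}) ?I"
  proof (subst indep_sets_finite)
    show "\<forall>A\<in>Pi ?I (\<lambda>j. {?V j -` A \<inter> space M | A. A \<in> sets borel}).
        prob (\<Inter>j\<in>?I. A j) = (\<Prod>j\<in>?I. prob (A j))"
    proof
      fix E assume "E \<in> Pi ?I (\<lambda>j. {?V j -` A \<inter> space M | A. A \<in> sets borel})"
      then have "\<forall>j\<in>?I. \<exists>A. E j = ?V j -` A \<inter> space M \<and> A \<in> sets borel"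
        by (auto simp: Pi_iff)
      then obtain A where A: "\<And>j. j \<in> ?I \<Longrightarrow> E j = ?V j -` A j \<inter> space M"
        "\<And>j. j \<in> ?I \<Longrightarrow> A j \<in> sets borel"
        by metis
      \<comment> \<open>The two events that concern \<open>Y k\<close> intersect in the preimage of
        the single set \<open>?B k\<close>. Independence of the \<open>Y k\<close> factors over
        \<open>k\<close>, and \<open>within\<close> then splits each factor in two.\<close>
      let ?B = "\<lambda>k. (f True -` A (k, True) \<inter> space S) \<inter> (f False -` A (k, False) \<inter> space S)"
      have B: "?B k \<in> sets S" if "k < n" for k
        using that A(2) by (intro sets.Int measurable_sets[OF f]) auto
      have E_B: "E (k, True) \<inter> E (k, False) = Y k -` ?B k \<inter> space M" if "k < n" for k
        using that A(1)[of "(k, True)"] A(1)[of "(k, False)"] measurable_space[OF Y] by auto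
      have "(\<Inter>j\<in>?I. E j) = (\<Inter>k<n. E (k, True) \<inter> E (k, False))"
        by (auto simp: UNIV_bool)
      also have "\<dots> = (\<Inter>k<n. Y k -` ?B k \<inter> space M)"
        using E_B by (intro INF_cong) auto
      finally have "prob (\<Inter>j\<in>?I. E j) = prob (\<Inter>k<n. Y k -` ?B k \<inter> space M)"
        by simp
      also have "\<dots> = (\<Prod>k<n. prob (Y k -` ?B k \<inter> space M))"
        using False B by (intro indep_varsD[OF ind]) auto
      also have "\<dots> = (\<Prod>k<n. prob (E (k, True)) * prob (E (k, False)))"
      proof (rule prod.cong[OF refl])
        fix k assume "k \<in> {..<n}"
        then show "prob (Y k -` ?B k \<inter> space M) = prob (E (k, True)) * prob (E (k, False))"
          using within[of "A (k, True)" "A (k, False)" k] A E_B[of k] by auto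
      qed
      also have "\<dots> = (\<Prod>k<n. \<Prod>b\<in>UNIV. prob (E (k, b)))"
        by (simp add: UNIV_bool mult.commute)
      also have "\<dots> = (\<Prod>j\<in>?I. prob (E j))"
        by (simp add: prod.cartesian_product)
      finally show "prob (\<Inter>j\<in>?I. E j) = (\<Prod>j\<in>?I. prob (E j))" .
    qed
    fix j assume "j \<in> ?I"
    show "{?V j -` A \<inter> space M | A. A \<in> sets borel} \<subseteq> events"
      using V by (auto intro: measurable_sets)
    show "space M \<in> {?V j -` A \<inter> space M | A. A \<in> sets borel}"
      by (auto intro!: exI[of _ UNIV])
  qed (use False in auto)
  then show ?thesis
    unfolding indep_vars_def2 using V by auto
qed

end

subsection \<open>The quadratic form\<close>

text \<open>Stated for one real sample, to show that the error in a coordinate is a function of that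
  coordinate of the sample alone. The independence argument rests on this.\<close>

definition score_deviation :: "nat \<Rightarrow> (nat \<Rightarrow> real) \<Rightarrow> nat \<Rightarrow> real" where
  "score_deviation n x i = std_normal_quantile (real (sample_rank n x i) / real (n + 1)) - x i"

lemma score_deviation_cong:
  assumes "\<And>k. k < n \<Longrightarrow> x k = y k" "i < n"
  shows "score_deviation n x i = score_deviation n y i"
proof -
  have "{k. k < n \<and> x k \<le> x i} = {k. k < n \<and> y k \<le> y i}"
    using assms by auto
  then show ?thesis
    using assms by (simp add: score_deviation_def sample_rank_def)
qed

lemma score_deviation_borel_measurable:
  assumes "\<And>k. k < n \<Longrightarrow> X k \<in> borel_measurable M" "i < n"
  shows "(\<lambda>\<omega>. score_deviation n (\<lambda>k. X k \<omega>) i) \<in> borel_measurable M"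
  unfolding score_deviation_def
  by (intro borel_measurable_diff assms(1)[OF assms(2)]
      measurable_compose[OF sample_rank_borel_measurable[OF assms]]) auto

lemma normal_scores_diff_nth:
  "(normal_scores n y i - y i) $ j = score_deviation n (\<lambda>k. y k $ j) i"
  by (simp add: normal_scores_def score_deviation_def)

text \<open>Expand \<open>x\<close> as \<open>y\<close> plus the difference; transposition merges
  the two cross terms. The result is written in coordinates because independence of error and factor
  holds only within one coordinate \<open>j\<close> at a time.\<close>

lemma quadratic_form_diff:
  fixes A :: "real ^ 'p ^ 'p" and x y :: "real ^ 'p"
  shows "x \<bullet> (A *v x) - y \<bullet> (A *v y) =
    (\<Sum>j\<in>UNIV. \<Sum>l\<in>UNIV. A $ j $ l * ((x - y) $ j * (x - y) $ l))
    + (\<Sum>j\<in>UNIV. (x - y) $ j * ((A + transpose A) $ j \<bullet> y))"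
proof -
  have "y \<bullet> (A *v (x - y)) = (x - y) \<bullet> (transpose A *v y)"
    by (metis dot_lmul_matrix inner_commute transpose_matrix_vector)
  then have "x \<bullet> (A *v x) - y \<bullet> (A *v y)
    = (x - y) \<bullet> (A *v (x - y)) + (x - y) \<bullet> ((A + transpose A) *v y)"
    by (simp add: matrix_vector_mult_add_rdistrib inner_add_right inner_diff_left
        matrix_vector_mult_diff_distrib inner_diff_right del: transpose_matrix_vector)
  also have "(x - y) \<bullet> (A *v (x - y)) = (\<Sum>j\<in>UNIV. \<Sum>l\<in>UNIV. A $ j $ l * ((x - y) $ j * (x - y) $ l))"
    unfolding inner_vec_def matrix_vector_mult_def by (simp add: sum_distrib_left mult_ac)
  also have "(x - y) \<bullet> ((A + transpose A) *v y) = (\<Sum>j\<in>UNIV. (x - y) $ j * ((A + transpose A) $ j \<bullet> y))"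
    by (simp add: inner_vec_def[of "x - y"] matrix_vector_mul_component del: vector_minus_component vector_add_component)
  finally show ?thesis .
qed

section \<open>Moment inequalities and convergence in probability\<close>

context prob_space
begin

lemma integrable_mult_of_squares:
  fixes X Y :: "'a \<Rightarrow> real"
  assumes [measurable]: "X \<in> borel_measurable M" "Y \<in> borel_measurable M"
    and int: "integrable M (\<lambda>\<omega>. (X \<omega>)\<^sup>2)" "integrable M (\<lambda>\<omega>. (Y \<omega>)\<^sup>2)"
  shows "integrable M (\<lambda>\<omega>. X \<omega> * Y \<omega>)"
    and "expectation (\<lambda>\<omega>. \<bar>X \<omega> * Y \<omega>\<bar>) \<le> (expectation (\<lambda>\<omega>. (X \<omega>)\<^sup>2) + expectation (\<lambda>\<omega>. (Y \<omega>)\<^sup>2)) / 2"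
proof -
  have bound: "\<bar>x * y\<bar> \<le> (x\<^sup>2 + y\<^sup>2) / 2" for x y :: real
    using zero_le_power2[of "\<bar>x\<bar> - \<bar>y\<bar>"] by (simp add: power2_diff abs_mult)
  have int': "integrable M (\<lambda>\<omega>. ((X \<omega>)\<^sup>2 + (Y \<omega>)\<^sup>2) / 2)"
    using int by simp
  show *: "integrable M (\<lambda>\<omega>. X \<omega> * Y \<omega>)"
    by (rule Bochner_Integration.integrable_bound[OF int']) (use bound in \<open>auto intro!: AE_I2\<close>)
  have "expectation (\<lambda>\<omega>. \<bar>X \<omega> * Y \<omega>\<bar>) \<le> expectation (\<lambda>\<omega>. ((X \<omega>)\<^sup>2 + (Y \<omega>)\<^sup>2) / 2)"
    using * int' bound by (intro integral_mono) auto
  then show "expectation (\<lambda>\<omega>. \<bar>X \<omega> * Y \<omega>\<bar>) \<le> (expectation (\<lambda>\<omega>. (X \<omega>)\<^sup>2) + expectation (\<lambda>\<omega>. (Y \<omega>)\<^sup>2)) / 2"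
    using int by simp
qed

text \<open>The second part is nonnegativity of the variance of
  \<open>\<bar>W \<omega>\<bar>\<close>.\<close>

lemma expectation_abs_le_sqrt:
  fixes W :: "'a \<Rightarrow> real"
  assumes [measurable]: "W \<in> borel_measurable M" and int: "integrable M (\<lambda>\<omega>. (W \<omega>)\<^sup>2)"
  shows "integrable M W" and "expectation (\<lambda>\<omega>. \<bar>W \<omega>\<bar>) \<le> sqrt (expectation (\<lambda>\<omega>. (W \<omega>)\<^sup>2))"
proof -
  show W: "integrable M W"
    using integrable_mult_of_squares(1)[of W "\<lambda>_. 1"] int by simp
  have "0 \<le> expectation (\<lambda>\<omega>. \<bar>W \<omega>\<bar>\<^sup>2) - (expectation (\<lambda>\<omega>. \<bar>W \<omega>\<bar>))\<^sup>2"
    using W int variance_positive[of "\<lambda>\<omega>. \<bar>W \<omega>\<bar>"] by (subst variance_eq[symmetric]) auto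
  then show "expectation (\<lambda>\<omega>. \<bar>W \<omega>\<bar>) \<le> sqrt (expectation (\<lambda>\<omega>. (W \<omega>)\<^sup>2))"
    by (intro real_le_rsqrt) simp
qed

text \<open>Expectations of the products factor by independence of \<open>U\<close> and
  \<open>V\<close>, and orthogonality of the \<open>z i\<close> removes the off-diagonal terms. The
  \<open>d i\<close> may depend on each other, as score errors do through the ranks.\<close>

lemma second_moment_independent_weighted_sum:
  fixes d :: "nat \<Rightarrow> 's \<Rightarrow> real" and z :: "nat \<Rightarrow> 's \<Rightarrow> real"
  assumes ind: "indep_var S U T V"
    and d [measurable]: "\<And>i. i < n \<Longrightarrow> d i \<in> borel_measurable S"
    and z [measurable]: "\<And>i. i < n \<Longrightarrow> z i \<in> borel_measurable T"
    and d2: "\<And>i. i < n \<Longrightarrow> integrable M (\<lambda>\<omega>. (d i (U \<omega>))\<^sup>2)"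
      "\<And>i. i < n \<Longrightarrow> expectation (\<lambda>\<omega>. (d i (U \<omega>))\<^sup>2) \<le> \<delta>"
    and z2: "\<And>i. i < n \<Longrightarrow> integrable M (\<lambda>\<omega>. (z i (V \<omega>))\<^sup>2)"
      "\<And>i. i < n \<Longrightarrow> expectation (\<lambda>\<omega>. (z i (V \<omega>))\<^sup>2) = v"
    and orth: "\<And>i l. i < n \<Longrightarrow> l < n \<Longrightarrow> i \<noteq> l \<Longrightarrow> expectation (\<lambda>\<omega>. z i (V \<omega>) * z l (V \<omega>)) = 0"
  shows "integrable M (\<lambda>\<omega>. (\<Sum>i<n. d i (U \<omega>) * z i (V \<omega>))\<^sup>2)"
    and "expectation (\<lambda>\<omega>. (\<Sum>i<n. d i (U \<omega>) * z i (V \<omega>))\<^sup>2) \<le> real n * \<delta> * v"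
proof -
  have U: "U \<in> measurable M S" and V: "V \<in> measurable M T"
    using ind by (auto dest: indep_var_rv1 indep_var_rv2)
  let ?d = "\<lambda>i l \<omega>. d i (U \<omega>) * d l (U \<omega>)" and ?z = "\<lambda>i l \<omega>. z i (V \<omega>) * z l (V \<omega>)"
  have int: "integrable M (?d i l)" "integrable M (?z i l)" if "i < n" "l < n" for i l
  proof -
    show "integrable M (?d i l)"
      by (rule integrable_mult_of_squares(1)[OF measurable_compose[OF U d] measurable_compose[OF U d] d2(1) d2(1)])
         (use that in auto)
    show "integrable M (?z i l)"
      by (rule integrable_mult_of_squares(1)[OF measurable_compose[OF V z] measurable_compose[OF V z] z2(1) z2(1)])
         (use that in auto)
  qed
  have indep: "indep_var borel (?d i l) borel (?z i l)" if "i < n" "l < n" for i l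
    using indep_var_compose[OF ind, of "\<lambda>x. d i x * d l x" borel "\<lambda>x. z i x * z l x" borel] that d z
    by (simp add: comp_def)
  have sq: "(\<Sum>i<n. d i (U \<omega>) * z i (V \<omega>))\<^sup>2 = (\<Sum>i<n. \<Sum>l<n. ?d i l \<omega> * ?z i l \<omega>)" for \<omega>
    by (simp add: power2_eq_square sum_product mult_ac)
  have int2: "integrable M (\<lambda>\<omega>. ?d i l \<omega> * ?z i l \<omega>)" if "i < n" "l < n" for i l
    using that by (intro indep_var_integrable indep int)
  show "integrable M (\<lambda>\<omega>. (\<Sum>i<n. d i (U \<omega>) * z i (V \<omega>))\<^sup>2)"
    unfolding sq by (intro Bochner_Integration.integrable_sum int2) auto
  have "expectation (\<lambda>\<omega>. (\<Sum>i<n. d i (U \<omega>) * z i (V \<omega>))\<^sup>2)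
    = (\<Sum>i<n. \<Sum>l<n. expectation (\<lambda>\<omega>. ?d i l \<omega> * ?z i l \<omega>))"
    unfolding sq
    by (subst Bochner_Integration.integral_sum, (intro Bochner_Integration.integrable_sum int2; simp),
        intro sum.cong refl Bochner_Integration.integral_sum int2) auto
  also have "\<dots> = (\<Sum>i<n. \<Sum>l<n. expectation (?d i l) * expectation (?z i l))"
    by (intro sum.cong refl indep_var_lebesgue_integral indep int) auto
  also have "\<dots> = (\<Sum>i<n. \<Sum>l<n. if l = i then expectation (\<lambda>\<omega>. (d i (U \<omega>))\<^sup>2) * v else 0)"
    using z2(2) orth by (intro sum.cong refl) (auto simp: power2_eq_square)
  also have "\<dots> = (\<Sum>i<n. expectation (\<lambda>\<omega>. (d i (U \<omega>))\<^sup>2) * v)"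
    by (intro sum.cong refl) simp
  also have "\<dots> \<le> (\<Sum>i<n. \<delta> * v)"
  proof (intro sum_mono mult_right_mono)
    fix i assume "i \<in> {..<n}"
    then show "expectation (\<lambda>\<omega>. (d i (U \<omega>))\<^sup>2) \<le> \<delta>" "0 \<le> v"
      using d2(2) z2(2)[of i, symmetric] by auto
  qed
  finally show "expectation (\<lambda>\<omega>. (\<Sum>i<n. d i (U \<omega>) * z i (V \<omega>))\<^sup>2) \<le> real n * \<delta> * v"
    by (simp add: mult.assoc)
qed

lemma normal_law_moments:
  fixes X :: "'a \<Rightarrow> real"
  assumes [measurable]: "X \<in> borel_measurable M" and dist: "distr M borel X = normal_law 0 s" and "0 \<le> s"
  shows "integrable M X" "integrable M (\<lambda>\<omega>. (X \<omega>)\<^sup>2)"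
    "expectation X = 0" "expectation (\<lambda>\<omega>. (X \<omega>)\<^sup>2) = s\<^sup>2"
proof -
  have dist': "distr M borel X = distr std_normal_distribution borel (\<lambda>x. s * x)"
    using dist normal_law_eq_distr[OF \<open>0 \<le> s\<close>] by simp
  have int: "integrable M (\<lambda>\<omega>. f (X \<omega>)) \<longleftrightarrow> integrable std_normal_distribution (\<lambda>x. f (s * x))"
    and E: "expectation (\<lambda>\<omega>. f (X \<omega>)) = (LINT x|std_normal_distribution. f (s * x))"
    if [measurable]: "f \<in> borel_measurable borel" for f :: "real \<Rightarrow> real"
    using arg_cong[OF dist', of "\<lambda>N. integrable N f"] arg_cong[OF dist', of "\<lambda>N. integral\<^sup>L N f"]
    by (simp_all add: integrable_distr_eq integral_distr)
  show "integrable M X" "expectation X = 0"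
    using int[of "\<lambda>x. x"] E[of "\<lambda>x. x"] integrable_std_normal_distribution_moment[of 1]
      integral_std_normal_distribution_moment_odd[of 1] by simp_all
  show "integrable M (\<lambda>\<omega>. (X \<omega>)\<^sup>2)" "expectation (\<lambda>\<omega>. (X \<omega>)\<^sup>2) = s\<^sup>2"
    using int[of "\<lambda>x. x\<^sup>2"] E[of "\<lambda>x. x\<^sup>2"] std_normal_distribution_even_moments[of 1]
    by (simp_all add: power_mult_distrib)
qed

lemma converges_in_probability_0_of_L1_bound:
  fixes T :: "nat \<Rightarrow> 'a \<Rightarrow> real"
  assumes int: "\<And>n. integrable M (T n)"
    and bound: "\<And>n. expectation (\<lambda>\<omega>. \<bar>T n \<omega>\<bar>) \<le> B n" and B: "B \<longlonglongrightarrow> 0"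
  shows "converges_in_probability M T 0"
  unfolding converges_in_probability_def
proof (intro conjI allI impI)
  show "T n \<in> borel_measurable M" for n
    using int by auto
  fix \<epsilon> :: real assume \<epsilon>: "0 < \<epsilon>"
  have [measurable]: "T n \<in> borel_measurable M" for n
    using int by auto
  have "prob {\<omega> \<in> space M. \<epsilon> < \<bar>T n \<omega> - 0\<bar>} \<le> B n / \<epsilon>" for n
  proof -
    have "prob {\<omega> \<in> space M. \<epsilon> < \<bar>T n \<omega> - 0\<bar>} \<le> prob {\<omega> \<in> space M. \<bar>T n \<omega>\<bar> \<ge> \<epsilon>}"
      by (intro finite_measure_mono) auto
    also have "\<dots> \<le> expectation (\<lambda>\<omega>. \<bar>T n \<omega>\<bar>) / \<epsilon>"
      using int \<epsilon> by (intro integral_Markov_inequality_measure[of _ _ "space M"]) auto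
    also have "\<dots> \<le> B n / \<epsilon>"
      using bound \<epsilon> by (simp add: divide_right_mono)
    finally show ?thesis .
  qed
  then have le: "\<forall>\<^sub>F n in sequentially. prob {\<omega> \<in> space M. \<epsilon> < \<bar>T n \<omega> - 0\<bar>} \<le> B n / \<epsilon>"
    by simp
  have "(\<lambda>n. B n / \<epsilon>) \<longlonglongrightarrow> 0"
    using tendsto_divide[OF B tendsto_const[of \<epsilon>]] \<epsilon> by simp
  from tendsto_sandwich[OF _ le tendsto_const this]
  show "(\<lambda>n. prob {\<omega> \<in> space M. \<epsilon> < \<bar>T n \<omega> - 0\<bar>}) \<longlonglongrightarrow> 0"
    by simp
qed

section \<open>Gaussian independence and the cross terms\<close>

text \<open>Vanishing covariance makes the quadratic form of \<open>C\<close> additive on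
  \<open>s *\<^sub>R a + t *\<^sub>R b\<close>, so the joint characteristic function
  factors.\<close>

lemma multivariate_normal_uncorrelated_imp_independent:
  fixes Y :: "'a \<Rightarrow> real ^ 'p"
  assumes Y: "multivariate_normal M Y 0 C" "correlation_matrix C"
    and uncorr: "a \<bullet> (C *v b) = 0" and AB: "A \<in> sets borel" "B \<in> sets borel"
  shows "prob (((\<lambda>\<omega>. a \<bullet> Y \<omega>) -` A \<inter> space M) \<inter> ((\<lambda>\<omega>. b \<bullet> Y \<omega>) -` B \<inter> space M))
    = prob ((\<lambda>\<omega>. a \<bullet> Y \<omega>) -` A \<inter> space M) * prob ((\<lambda>\<omega>. b \<bullet> Y \<omega>) -` B \<inter> space M)"
proof (rule prob_Int_eq_of_char_factorizes[OF _ _ _ AB])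
  have [measurable]: "Y \<in> borel_measurable M"
    using Y(1) by (simp add: multivariate_normal_def)
  show "(\<lambda>\<omega>. a \<bullet> Y \<omega>) \<in> borel_measurable M" "(\<lambda>\<omega>. b \<bullet> Y \<omega>) \<in> borel_measurable M"
    by measurable
  fix s t :: real
  let ?q = "\<lambda>w. w \<bullet> (C *v w)"
  have "b \<bullet> (C *v a) = a \<bullet> (transpose C *v b)"
    by (metis dot_lmul_matrix inner_commute transpose_matrix_vector)
  then have uncorr': "b \<bullet> (C *v a) = 0"
    using Y(2) uncorr by (simp add: correlation_matrix_def del: transpose_matrix_vector)
  have q_add: "?q (s *\<^sub>R a + t *\<^sub>R b) = ?q (s *\<^sub>R a) + ?q (t *\<^sub>R b)"
    using uncorr uncorr' by (simp add: matrix_vector_right_distrib matrix_vector_mult_scaleR inner_add_left inner_add_right)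
  have char: "(CLINT \<omega>|M. iexp (w \<bullet> Y \<omega>)) = of_real (exp (- ?q w / 2))" for w
    by (rule multivariate_normal_char[OF Y])
  have "(CLINT \<omega>|M. iexp (s * (a \<bullet> Y \<omega>) + t * (b \<bullet> Y \<omega>))) = (CLINT \<omega>|M. iexp ((s *\<^sub>R a + t *\<^sub>R b) \<bullet> Y \<omega>))"
    by (simp add: inner_add_left)
  also have "\<dots> = of_real (exp (- ?q (s *\<^sub>R a) / 2) * exp (- ?q (t *\<^sub>R b) / 2))"
    unfolding char q_add by (simp only: exp_add[symmetric] add_divide_distrib minus_add_distrib)
  also have "\<dots> = (CLINT \<omega>|M. iexp ((s *\<^sub>R a) \<bullet> Y \<omega>)) * (CLINT \<omega>|M. iexp ((t *\<^sub>R b) \<bullet> Y \<omega>))"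
    unfolding char by simp
  finally show "(CLINT \<omega>|M. iexp (s * (a \<bullet> Y \<omega>) + t * (b \<bullet> Y \<omega>)))
    = (CLINT \<omega>|M. iexp (s * (a \<bullet> Y \<omega>))) * (CLINT \<omega>|M. iexp (t * (b \<bullet> Y \<omega>)))"
    by simp
qed

lemma score_deviation_second_moment:
  fixes X :: "nat \<Rightarrow> 'a \<Rightarrow> real"
  assumes ind: "indep_vars (\<lambda>_. borel) X UNIV"
    and dist: "\<And>k. distr M borel (X k) = std_normal_distribution" and "i < n"
  shows "integrable M (\<lambda>\<omega>. (score_deviation n (\<lambda>k. X k \<omega>) i)\<^sup>2)"
    and "expectation (\<lambda>\<omega>. (score_deviation n (\<lambda>k. X k \<omega>) i)\<^sup>2) \<le> score_error n"
proof -
  have X: "X k \<in> borel_measurable M" for k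
    using ind unfolding indep_vars_def by simp
  have [measurable]: "(\<lambda>\<omega>. score_deviation n (\<lambda>k. X k \<omega>) i) \<in> borel_measurable M"
    by (rule score_deviation_borel_measurable[OF X \<open>i < n\<close>])
  have le: "(\<integral>\<^sup>+\<omega>. ennreal ((score_deviation n (\<lambda>k. X k \<omega>) i)\<^sup>2) \<partial>M) \<le> ennreal (score_error n)"
    unfolding score_deviation_def by (rule normal_score_deviation[OF prob_space_axioms ind dist \<open>i < n\<close>])
  then show "integrable M (\<lambda>\<omega>. (score_deviation n (\<lambda>k. X k \<omega>) i)\<^sup>2)"
    by (intro integrableI_nonneg) (auto intro: le_less_trans)
  show "expectation (\<lambda>\<omega>. (score_deviation n (\<lambda>k. X k \<omega>) i)\<^sup>2) \<le> score_error n"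
    by (rule integral_real_bounded[OF score_error_nonneg le])
qed

text \<open>The errors are functions of the \<open>j\<close>-th components of the sample only, and
  these are independent of all the factors \<open>b \<bullet> Y i \<omega>\<close>. The factors are
  centred and independent of each other, hence orthogonal, so the second moment grows like
  \<open>n\<close> rather than its square.\<close>

lemma cross_term_second_moment:
  fixes Y :: "nat \<Rightarrow> 'a \<Rightarrow> real ^ 'p" and b :: "real ^ 'p"
  assumes C: "correlation_matrix C" and mvn: "\<And>k. multivariate_normal M (Y k) 0 C"
    and ind: "indep_vars (\<lambda>_. borel) Y UNIV"
    and dist: "\<And>k. distr M borel (\<lambda>\<omega>. Y k \<omega> $ j) = std_normal_distribution"
    and uncorr: "axis j 1 \<bullet> (C *v b) = 0"
  defines "W \<equiv> \<lambda>n \<omega>. \<Sum>i<n. score_deviation n (\<lambda>k. Y k \<omega> $ j) i * (b \<bullet> Y i \<omega>)"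
  shows "integrable M (\<lambda>\<omega>. (W n \<omega>)\<^sup>2)"
    and "expectation (\<lambda>\<omega>. (W n \<omega>)\<^sup>2) \<le> real n * score_error n * (b \<bullet> (C *v b))"
proof -
  let ?f = "\<lambda>c y. if c then y $ j else b \<bullet> y"
  let ?V = "\<lambda>p \<omega>. ?f (snd p) (Y (fst p) \<omega>)"
  let ?X = "{..<n} \<times> {True}" and ?Z = "{..<n} \<times> {False}"
  have nth_eq: "y $ j = axis j 1 \<bullet> y" for y :: "real ^ 'p"
    by (simp add: inner_axis')
  have Y [measurable]: "Y k \<in> borel_measurable M" for k
    using ind unfolding indep_vars_def by simp
  have b_meas [measurable]: "(\<lambda>y. b \<bullet> y) \<in> borel_measurable borel"
    by (intro borel_measurable_continuous_onI continuous_intros)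
  have j_meas [measurable]: "(\<lambda>y. y $ j) \<in> borel_measurable (borel :: (real ^ 'p) measure)"
    by (intro borel_measurable_continuous_onI continuous_intros)
  have "indep_vars (\<lambda>_. borel) ?V ({..<n} \<times> UNIV)"
  proof (rule indep_vars_pairs[OF ind])
    show "?f c \<in> borel_measurable borel" for c
      by (cases c) (simp_all add: b_meas j_meas)
    show "prob ((\<lambda>\<omega>. ?f True (Y k \<omega>)) -` A \<inter> space M \<inter> ((\<lambda>\<omega>. ?f False (Y k \<omega>)) -` B \<inter> space M))
      = prob ((\<lambda>\<omega>. ?f True (Y k \<omega>)) -` A \<inter> space M) * prob ((\<lambda>\<omega>. ?f False (Y k \<omega>)) -` B \<inter> space M)"
      if "A \<in> sets borel" "B \<in> sets borel" for k A B
      using multivariate_normal_uncorrelated_imp_independent[OF mvn C uncorr that, of k]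
      by (simp add: nth_eq)
  qed
  \<comment> \<open>Joint independence is cut into two blocks: the whole family of
    \<open>j\<close>-th components against the whole family of factors.\<close>
  then have indep: "indep_var (PiM ?X (\<lambda>_. borel)) (\<lambda>\<omega>. restrict (\<lambda>p. ?V p \<omega>) ?X)
      (PiM ?Z (\<lambda>_. borel)) (\<lambda>\<omega>. restrict (\<lambda>p. ?V p \<omega>) ?Z)"
    by (rule indep_var_restrict) auto
  let ?d = "\<lambda>i x. score_deviation n (\<lambda>k. x (k, True)) i"
  have d_eq: "?d i (restrict (\<lambda>p. ?V p \<omega>) ?X) = score_deviation n (\<lambda>k. Y k \<omega> $ j) i" if "i < n" for i \<omega>
    using that by (intro score_deviation_cong) auto
  have law: "distr M borel (\<lambda>\<omega>. b \<bullet> Y k \<omega>) = normal_law 0 (sqrt (b \<bullet> (C *v b)))" for k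
    using mvn[of k] by (simp add: multivariate_normal_def)
  have v: "0 \<le> b \<bullet> (C *v b)"
    using C by (simp add: correlation_matrix_def)
  have Z: "(\<lambda>\<omega>. b \<bullet> Y k \<omega>) \<in> borel_measurable M" for k
    by measurable
  note moments = normal_law_moments[OF Z law real_sqrt_ge_zero[OF v]]
  have ind_Z: "indep_vars (\<lambda>_. borel) (\<lambda>k \<omega>. b \<bullet> Y k \<omega>) UNIV"
    by (rule indep_vars_compose2[OF ind]) measurable
  have ind_X: "indep_vars (\<lambda>_. borel) (\<lambda>k \<omega>. Y k \<omega> $ j) UNIV"
    by (rule indep_vars_compose2[OF ind]) measurable
  have orth: "expectation (\<lambda>\<omega>. (b \<bullet> Y i \<omega>) * (b \<bullet> Y l \<omega>)) = 0" if "i \<noteq> l" for i l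
    using indep_vars_lebesgue_integral[OF _ indep_vars_subset[OF ind_Z, of "{i, l}"]] moments that
    by simp
  note dev = score_deviation_second_moment[OF ind_X dist]
  let ?U = "\<lambda>\<omega>. restrict (\<lambda>p. ?V p \<omega>) ?X" and ?T = "\<lambda>\<omega>. restrict (\<lambda>p. ?V p \<omega>) ?Z"
  let ?z = "\<lambda>i x. x (i, False) :: real"
  have d_meas: "?d i \<in> borel_measurable (PiM ?X (\<lambda>_. borel))" if "i < n" for i
    using that by (intro score_deviation_borel_measurable measurable_component_singleton) auto
  have z_meas: "?z i \<in> borel_measurable (PiM ?Z (\<lambda>_. borel))" if "i < n" for i
    using that by (intro measurable_component_singleton) auto
  have z_eq: "?z i (?T \<omega>) = b \<bullet> Y i \<omega>" if "i < n" for i \<omega>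
    using that by simp
  have W_eq: "W n \<omega> = (\<Sum>i<n. ?d i (?U \<omega>) * ?z i (?T \<omega>))" for \<omega>
    unfolding W_def by (intro sum.cong refl) (simp only: d_eq z_eq lessThan_iff)
  have prem: "i < n \<Longrightarrow> integrable M (\<lambda>\<omega>. (?d i (?U \<omega>))\<^sup>2)"
    "i < n \<Longrightarrow> expectation (\<lambda>\<omega>. (?d i (?U \<omega>))\<^sup>2) \<le> score_error n"
    "i < n \<Longrightarrow> integrable M (\<lambda>\<omega>. (?z i (?T \<omega>))\<^sup>2)"
    "i < n \<Longrightarrow> expectation (\<lambda>\<omega>. (?z i (?T \<omega>))\<^sup>2) = b \<bullet> (C *v b)"
    "i < n \<Longrightarrow> l < n \<Longrightarrow> i \<noteq> l \<Longrightarrow> expectation (\<lambda>\<omega>. ?z i (?T \<omega>) * ?z l (?T \<omega>)) = 0" for i l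
    using dev moments orth v by (simp_all only: d_eq z_eq real_sqrt_pow2)
  note W2 = second_moment_independent_weighted_sum[where d="?d" and z="?z" and U="?U" and V="?T",
      OF indep d_meas z_meas prem]
  show "integrable M (\<lambda>\<omega>. (W n \<omega>)\<^sup>2)"
    unfolding W_eq by (rule W2(1))
  show "expectation (\<lambda>\<omega>. (W n \<omega>)\<^sup>2) \<le> real n * score_error n * (b \<bullet> (C *v b))"
    unfolding W_eq by (rule W2(2))
qed

end

section \<open>Assembling the estimates\<close>

theorem theorem3p1:
  fixes M :: "'a measure"
    and Y :: "nat \<Rightarrow> 'a \<Rightarrow> real ^ 'p"
    and A C :: "real ^ 'p ^ 'p"
  assumes "prob_space M"
    and "correlation_matrix C"
    and "\<And>i. multivariate_normal M (Y i) 0 C"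
    and "prob_space.indep_vars M (\<lambda>_. borel) Y UNIV"
    and "\<And>j. (A ** C + transpose A ** C) $ j $ j = 0"
  shows "converges_in_probability M
           (\<lambda>n \<omega>. 1 / sqrt (real n) *
              (\<Sum>i<n. normal_scores n (\<lambda>k. Y k \<omega>) i \<bullet> (A *v normal_scores n (\<lambda>k. Y k \<omega>) i)
                      - Y i \<omega> \<bullet> (A *v Y i \<omega>))) 0"
proof -
  interpret prob_space M by fact
  note C = assms(2) and mvn = assms(3) and ind = assms(4)
  define b where "b j = (A + transpose A) $ j" for j
  define D where "D n j i \<omega> = score_deviation n (\<lambda>k. Y k \<omega> $ j) i" for n j i \<omega>
  define W where "W n j \<omega> = (\<Sum>i<n. D n j i \<omega> * (b j \<bullet> Y i \<omega>))" for n j \<omega>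
  define Q where "Q n \<omega> = (\<Sum>i<n. \<Sum>j\<in>UNIV. \<Sum>l\<in>UNIV. A $ j $ l * (D n j i \<omega> * D n l i \<omega>))" for n \<omega>
  define T where "T n \<omega> = 1 / sqrt (real n) * Q n \<omega> + (\<Sum>j\<in>UNIV. 1 / sqrt (real n) * W n j \<omega>)" for n \<omega>
  define v where "v j = b j \<bullet> (C *v b j)" for j
  \<comment> \<open>The first summand bounds the purely quadratic part \<open>Q\<close> and requires
    \<open>score_error\<close> to be o(1 / sqrt n); the second bounds the cross terms
    \<open>W\<close>, for which convergence of \<open>score_error\<close> to 0 is enough.\<close>
  define B where "B n = sqrt (real n) * score_error n * (\<Sum>j\<in>UNIV. \<Sum>l\<in>UNIV. \<bar>A $ j $ l\<bar>)
    + (\<Sum>j\<in>UNIV. sqrt (score_error n * v j))" for n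
  have Y [measurable]: "Y k \<in> borel_measurable M" for k
    using ind unfolding indep_vars_def by simp
  have j_meas: "(\<lambda>y. y $ j) \<in> borel_measurable (borel :: (real ^ 'p) measure)" for j
    by (intro borel_measurable_continuous_onI continuous_intros)
  \<comment> \<open>As \<open>C\<close> is symmetric and \<open>b j\<close> is the
    \<open>j\<close>-th row of \<open>A + transpose A\<close>, this covariance is exactly the
    \<open>j\<close>-th diagonal entry assumed to vanish.\<close>
  have uncorr: "axis j 1 \<bullet> (C *v b j) = 0" for j
  proof -
    have "axis j 1 \<bullet> (C *v b j) = (\<Sum>k\<in>UNIV. C $ j $ k * b j $ k)"
      by (simp add: inner_axis' matrix_vector_mult_def)
    also have "\<dots> = (\<Sum>k\<in>UNIV. A $ j $ k * C $ k $ j + transpose A $ j $ k * C $ k $ j)"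
      using C unfolding correlation_matrix_def b_def
      by (intro sum.cong refl) (metis (no_types, lifting) transpose_def vec_lambda_beta vector_add_component
          distrib_right mult.commute)
    also have "\<dots> = (A ** C + transpose A ** C) $ j $ j"
      by (simp add: matrix_matrix_mult_def sum.distrib)
    finally show ?thesis
      using assms(5) by simp
  qed
  have dist: "distr M borel (\<lambda>\<omega>. Y k \<omega> $ j) = std_normal_distribution" for k j
  proof -
    \<comment> \<open>The unit diagonal of \<open>C\<close> makes every component standard
      normal.\<close>
    have "axis j 1 \<bullet> (C *v axis j 1) = 1"
      using C by (simp add: correlation_matrix_def inner_axis' matrix_vector_mult_basis column_def)
    moreover have "distr M borel (\<lambda>\<omega>. axis j 1 \<bullet> Y k \<omega>) = normal_law 0 (sqrt (axis j 1 \<bullet> (C *v axis j 1)))"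
      using mvn[of k] unfolding multivariate_normal_def by simp
    ultimately show ?thesis
      by (simp add: inner_axis' normal_law_def)
  qed
  have ind_X: "indep_vars (\<lambda>_. borel) (\<lambda>k \<omega>. Y k \<omega> $ j) UNIV" for j
    by (rule indep_vars_compose2[OF ind j_meas])
  have D_meas [measurable]: "D n j i \<in> borel_measurable M" if "i < n" for n j i
    unfolding D_def using that by (intro score_deviation_borel_measurable measurable_compose[OF Y j_meas])
  have D2: "integrable M (\<lambda>\<omega>. (D n j i \<omega>)\<^sup>2)" "expectation (\<lambda>\<omega>. (D n j i \<omega>)\<^sup>2) \<le> score_error n"
    if "i < n" for n j i
    unfolding D_def using score_deviation_second_moment[OF ind_X dist that] by auto
  have DD: "integrable M (\<lambda>\<omega>. D n j i \<omega> * D n l i \<omega>)"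
    "expectation (\<lambda>\<omega>. \<bar>D n j i \<omega> * D n l i \<omega>\<bar>) \<le> score_error n" if "i < n" for n j l i
  proof -
    note DD = integrable_mult_of_squares[OF D_meas D_meas D2(1) D2(1), OF that that that that]
    show "integrable M (\<lambda>\<omega>. D n j i \<omega> * D n l i \<omega>)"
      by (rule DD(1))
    show "expectation (\<lambda>\<omega>. \<bar>D n j i \<omega> * D n l i \<omega>\<bar>) \<le> score_error n"
    proof (rule order_trans[OF DD(2)])
      have "(x + y) / 2 \<le> s" if "x \<le> s" "y \<le> s" for x y s :: real
        using that by simp
      then show "(expectation (\<lambda>\<omega>. (D n j i \<omega>)\<^sup>2) + expectation (\<lambda>\<omega>. (D n l i \<omega>)\<^sup>2)) / 2 \<le> score_error n"
        using D2(2)[OF that] by blast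
    qed
  qed
  have W_meas [measurable]: "W n j \<in> borel_measurable M" for n j
    unfolding W_def by (intro borel_measurable_sum borel_measurable_times D_meas) auto
  have W2: "integrable M (\<lambda>\<omega>. (W n j \<omega>)\<^sup>2)" "expectation (\<lambda>\<omega>. (W n j \<omega>)\<^sup>2) \<le> real n * score_error n * v j" for n j
    unfolding W_def D_def v_def by (rule cross_term_second_moment[OF C mvn ind dist uncorr])+
  have W: "integrable M (W n j)" "expectation (\<lambda>\<omega>. \<bar>1 / sqrt (real n) * W n j \<omega>\<bar>) \<le> sqrt (score_error n * v j)" for n j
  proof -
    show "integrable M (W n j)"
      by (rule expectation_abs_le_sqrt(1)[OF W_meas W2(1)])
    have v: "0 \<le> v j"
      using C by (simp add: v_def correlation_matrix_def)
    have "expectation (\<lambda>\<omega>. \<bar>W n j \<omega>\<bar>) \<le> sqrt (real n * score_error n * v j)"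
      using expectation_abs_le_sqrt(2)[OF W_meas W2(1), of n j] W2(2)[of n j]
      by (meson order_trans real_sqrt_le_mono)
    also have "\<dots> = sqrt (real n) * sqrt (score_error n * v j)"
      by (simp add: real_sqrt_mult)
    finally have "1 / sqrt (real n) * expectation (\<lambda>\<omega>. \<bar>W n j \<omega>\<bar>)
      \<le> 1 / sqrt (real n) * (sqrt (real n) * sqrt (score_error n * v j))"
      by (rule mult_left_mono) simp
    \<comment> \<open>An equality for positive \<open>n\<close>; at \<open>n = 0\<close> division by
      zero makes the left side 0, so only the inequality is claimed.\<close>
    also have "\<dots> \<le> sqrt (score_error n * v j)"
      using v score_error_nonneg[of n] by (cases "n = 0") auto
    finally show "expectation (\<lambda>\<omega>. \<bar>1 / sqrt (real n) * W n j \<omega>\<bar>) \<le> sqrt (score_error n * v j)"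
      by (simp add: abs_mult)
  qed
  have Q: "integrable M (Q n)"
    "expectation (\<lambda>\<omega>. \<bar>Q n \<omega>\<bar>) \<le> real n * score_error n * (\<Sum>j\<in>UNIV. \<Sum>l\<in>UNIV. \<bar>A $ j $ l\<bar>)" for n
  proof -
    show int: "integrable M (Q n)"
      unfolding Q_def by (intro Bochner_Integration.integrable_sum integrable_mult_right DD(1)) auto
    let ?R = "\<lambda>\<omega>. \<Sum>i<n. \<Sum>j\<in>UNIV. \<Sum>l\<in>UNIV. \<bar>A $ j $ l\<bar> * \<bar>D n j i \<omega> * D n l i \<omega>\<bar>"
    have int_R: "integrable M (\<lambda>\<omega>. \<bar>A $ j $ l\<bar> * \<bar>D n j i \<omega> * D n l i \<omega>\<bar>)" if "i < n" for i j l
      using DD(1)[OF that] by (intro integrable_mult_right integrable_abs)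
    have "expectation (\<lambda>\<omega>. \<bar>Q n \<omega>\<bar>) \<le> expectation ?R"
    proof (rule integral_mono)
      show "integrable M ?R"
        by (intro Bochner_Integration.integrable_sum int_R) auto
      show "\<bar>Q n \<omega>\<bar> \<le> ?R \<omega>" for \<omega>
        unfolding Q_def by (intro order_trans[OF sum_abs] sum_mono) (simp add: abs_mult)
    qed (use int in auto)
    also have "\<dots> = (\<Sum>i<n. \<Sum>j\<in>UNIV. \<Sum>l\<in>UNIV. expectation (\<lambda>\<omega>. \<bar>A $ j $ l\<bar> * \<bar>D n j i \<omega> * D n l i \<omega>\<bar>))"
      using int_R by (simp add: Bochner_Integration.integral_sum)
    also have "\<dots> \<le> (\<Sum>i<n. \<Sum>j\<in>UNIV. \<Sum>l\<in>UNIV. \<bar>A $ j $ l\<bar> * score_error n)"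
      using DD(2) by (intro sum_mono) (simp add: mult_left_mono)
    also have "\<dots> = real n * score_error n * (\<Sum>j\<in>UNIV. \<Sum>l\<in>UNIV. \<bar>A $ j $ l\<bar>)"
      by (simp add: sum_distrib_left mult_ac)
    finally show "expectation (\<lambda>\<omega>. \<bar>Q n \<omega>\<bar>) \<le> \<dots>" .
  qed
  have T_int: "integrable M (T n)" for n
    unfolding T_def
    by (intro Bochner_Integration.integrable_add Bochner_Integration.integrable_sum integrable_mult_right Q(1) W(1))
  have T_bound: "expectation (\<lambda>\<omega>. \<bar>T n \<omega>\<bar>) \<le> B n" for n
  proof -
    have "expectation (\<lambda>\<omega>. \<bar>T n \<omega>\<bar>)
      \<le> expectation (\<lambda>\<omega>. 1 / sqrt (real n) * \<bar>Q n \<omega>\<bar> + (\<Sum>j\<in>UNIV. \<bar>1 / sqrt (real n) * W n j \<omega>\<bar>))"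
    proof (rule integral_mono)
      show "\<bar>T n \<omega>\<bar> \<le> 1 / sqrt (real n) * \<bar>Q n \<omega>\<bar> + (\<Sum>j\<in>UNIV. \<bar>1 / sqrt (real n) * W n j \<omega>\<bar>)" for \<omega>
        unfolding T_def by (rule order_trans[OF abs_triangle_ineq]) (intro add_mono sum_abs, simp add: abs_mult)
    qed (intro Bochner_Integration.integrable_add Bochner_Integration.integrable_sum integrable_mult_right
          integrable_abs Q(1) W(1) T_int)+
    also have "\<dots> = 1 / sqrt (real n) * expectation (\<lambda>\<omega>. \<bar>Q n \<omega>\<bar>)
      + (\<Sum>j\<in>UNIV. expectation (\<lambda>\<omega>. \<bar>1 / sqrt (real n) * W n j \<omega>\<bar>))"
    proof -
      have 1: "integrable M (\<lambda>\<omega>. 1 / sqrt (real n) * \<bar>Q n \<omega>\<bar>)"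
        by (intro integrable_mult_right integrable_abs Q(1))
      have 2: "integrable M (\<lambda>\<omega>. \<bar>1 / sqrt (real n) * W n j \<omega>\<bar>)" for j
        by (intro integrable_mult_right integrable_abs W(1))
      show ?thesis
        by (simp only: Bochner_Integration.integral_add[OF 1 Bochner_Integration.integrable_sum[OF 2]]
            Bochner_Integration.integral_sum[OF 2] integral_mult_right_zero)
    qed
    also have "\<dots> \<le> 1 / sqrt (real n) * (real n * score_error n * (\<Sum>j\<in>UNIV. \<Sum>l\<in>UNIV. \<bar>A $ j $ l\<bar>))
      + (\<Sum>j\<in>UNIV. sqrt (score_error n * v j))"
      by (intro add_mono mult_left_mono Q(2) sum_mono W(2)) simp
    also have "1 / sqrt (real n) * (real n * score_error n * (\<Sum>j\<in>UNIV. \<Sum>l\<in>UNIV. \<bar>A $ j $ l\<bar>))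
      = (real n / sqrt (real n)) * score_error n * (\<Sum>j\<in>UNIV. \<Sum>l\<in>UNIV. \<bar>A $ j $ l\<bar>)"
      by simp
    also have "real n / sqrt (real n) = sqrt (real n)"
      by (simp add: real_div_sqrt)
    finally show ?thesis
      by (simp add: B_def)
  qed
  have "(\<lambda>n. sqrt (score_error n * v j)) \<longlonglongrightarrow> sqrt (0 * v j)" for j
    by (intro tendsto_intros score_error_tendsto_0)
  then have "B \<longlonglongrightarrow> 0 * (\<Sum>j\<in>UNIV. \<Sum>l\<in>UNIV. \<bar>A $ j $ l\<bar>) + (\<Sum>j\<in>UNIV. sqrt (0 * v j))"
    unfolding B_def by (intro tendsto_add tendsto_mult sqrt_score_error_tendsto_0 tendsto_const tendsto_sum)
  then have B: "B \<longlonglongrightarrow> 0"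
    by simp
  have "converges_in_probability M T 0"
    by (rule converges_in_probability_0_of_L1_bound[OF T_int T_bound B])
  moreover have "(\<lambda>n \<omega>. 1 / sqrt (real n) *
      (\<Sum>i<n. normal_scores n (\<lambda>k. Y k \<omega>) i \<bullet> (A *v normal_scores n (\<lambda>k. Y k \<omega>) i)
              - Y i \<omega> \<bullet> (A *v Y i \<omega>))) = T"
  proof (intro ext)
    fix n \<omega>
    have "(\<Sum>i<n. normal_scores n (\<lambda>k. Y k \<omega>) i \<bullet> (A *v normal_scores n (\<lambda>k. Y k \<omega>) i)
        - Y i \<omega> \<bullet> (A *v Y i \<omega>))
      = (\<Sum>i<n. (\<Sum>j\<in>UNIV. \<Sum>l\<in>UNIV. A $ j $ l * (D n j i \<omega> * D n l i \<omega>))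
        + (\<Sum>j\<in>UNIV. D n j i \<omega> * (b j \<bullet> Y i \<omega>)))"
      by (simp only: quadratic_form_diff normal_scores_diff_nth[of n "\<lambda>k. Y k \<omega>"] D_def b_def)
    also have "\<dots> = Q n \<omega> + (\<Sum>j\<in>UNIV. W n j \<omega>)"
      \<comment> \<open>The cross terms are regrouped by coordinate, so that the sum over
        observations, where the cancellation happens, is innermost.\<close>
      unfolding sum.distrib Q_def W_def by (subst (2) sum.swap) simp
    finally show "1 / sqrt (real n) *
      (\<Sum>i<n. normal_scores n (\<lambda>k. Y k \<omega>) i \<bullet> (A *v normal_scores n (\<lambda>k. Y k \<omega>) i)
              - Y i \<omega> \<bullet> (A *v Y i \<omega>)) = T n \<omega>"
      by (simp only: T_def distrib_left sum_distrib_left)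
  qed
  ultimately show ?thesis
    by simp
qed

end
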